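(* Let $R$ be a ring as described in the context, with valuation semigroup $v(R)$ and associated complete numerical semigroup ring $\Bbbk[[v(R)]]$. Then: (1) $R$ is of minimal reduced type if and only if $\Bbbk[[v(R)]]$ is of minimal reduced type. (2) $R$ is of maximal reduced type if $\Bbbk[[v(R)]]$ is of maximal reduced type. The converse holds if additionally $\operatorname{type}(R)=\operatorname{type}(\Bbbk[[v(R)]])$. Moreover, when $R$ is of minimal multiplicity or when $R$ is almost Gorenstein, $R$ is of maximal reduced type if and only if $\Bbbk[[v(R)]]$ is of maximal reduced type.
   Context: $\Bbbk$ is an algebraically closed field of characteristic $0$. $(R,\mathfrak m,\Bbbk)$ is a non-regular one-dimensional complete local domain which is a $\Bbbk$-algebra, with integral closure $\overline R=\Bbbk[[t]]$ in its fraction field. Write $R\cong \Bbbk[[X_1,\dots,X_n]]/I$ with $I\subseteq (X_1,\dots,X_n)^2$, and let the image of $X_i$ be $x_i=\alpha_i t^{a_i}$ with $\alpha_i$ a unit of $\overline R$, arranged so that $a_1<a_2<\dots<a_n$; here $n=\operatorname{edim}(R)\ge 2$ is the embedding dimension. The $t$-adic order valuation $v$ on $\overline R$ restricts to $R$; $v(R)=\{v(r): 0\ne r\in R\}$ is the valuation semigroup of $R$. For a numerical semigroup $H\neq\mathbb{Z}_{\ge 0}$ minimally generated by $b_1<\dots<b_m$, $\Bbbk[[H]]=\Bbbk[[t^{b_1},\dots,t^{b_m}]]$; it is again a non-regular one-dimensional complete local domain which is a $\Bbbk$-algebra, with integral closure $\Bbbk[[t]]$ in its fraction field, and with $t^{b_1},\dots,t^{b_m}$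 playing the role of $x_1,\dots,x_n$. The conductor is $\mathfrak C=R:_{\operatorname{Frac}(R)}\overline R$. The reduced type is $s(R)=\dim_{\Bbbk}\frac{\mathfrak C+x_1R}{x_1R}$, and $\operatorname{type}(R)=\dim_\Bbbk \frac{x_1R:_R\mathfrak m}{x_1R}$ is the Cohen–Macaulay type; one has $1\le s(R)\le \operatorname{type}(R)$. $R$ is of maximal reduced type if $s(R)=\operatorname{type}(R)$, and of minimal reduced type if $s(R)=1$. $R$ is of minimal multiplicity if $\operatorname{edim}(R)=e(R)$, where $e(R)$ is the multiplicity. $R$ is almost Gorenstein if $\ell(\overline R/R)=\ell(R/\mathfrak C)+\operatorname{type}(R)-1$, where $\ell$ denotes length. *)

theory Defs
  imports
    "HOL-Algebra.Ring_Divisibility"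
    "HOL-Algebra.Ideal_Product"
    "HOL-Algebra.Module"
    "HOL-Analysis.Infinite_Sum"
    "HOL-Computational_Algebra.Formal_Laurent_Series"
    "HOL-Library.Extended_Real"
begin

text \<open>
  All rings in question lie between a field \<open>k\<close> and its power series ring \<open>k[[t]]\<close>, and share
  their integral closure \<open>k[[t]]\<close> and their fraction field \<open>k((t))\<close>.  They are represented as
  subsets of the type of formal Laurent series over \<open>k\<close>; the ring theory is that of the
  following records.
\<close>

definition ring_on :: "'k::field fls set \<Rightarrow> 'k fls ring" where
  "ring_on R = \<lparr>carrier = R, monoid.mult = (*), one = 1, zero = 0, add = (+)\<rparr>"

definition laurent_module :: "('k::field fls, 'k fls) module" where
  "laurent_module =
     \<lparr>carrier = UNIV, monoid.mult = (*), one = 1, zero = 0, add = (+), module.smult = (*)\<rparr>"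


subsection \<open>Dimension and length of quotients\<close>

text \<open>The elements of \<open>S\<close> have linearly independent (in particular distinct) classes modulo \<open>B\<close>.\<close>

definition lin_indep_mod :: "'k::field fls set \<Rightarrow> 'k fls set \<Rightarrow> bool" where
  "lin_indep_mod B S \<longleftrightarrow>
     (\<forall>c. (\<Sum>s\<in>S. fls_const (c s) * s) \<in> B \<longrightarrow> (\<forall>s\<in>S. c s = 0))"

text \<open>The dimension of \<open>A/B\<close> over \<open>k\<close>, for \<open>k\<close>-subspaces \<open>B \<subseteq> A\<close>.\<close>

definition quot_dim :: "'k::field fls set \<Rightarrow> 'k fls set \<Rightarrow> enat" where
  "quot_dim A B = Sup {enat (card S) | S. finite S \<and> S \<subseteq> A \<and> lin_indep_mod B S}"

text \<open>
  The length of the \<open>R\<close>-module \<open>M/N\<close>, for \<open>R\<close>-submodules \<open>N \<subseteq> M\<close> of \<open>k((t))\<close>: submodules of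
  the quotient are given by the submodules between \<open>N\<close> and \<open>M\<close>.
\<close>

definition quot_length :: "'k::field fls set \<Rightarrow> 'k fls set \<Rightarrow> 'k fls set \<Rightarrow> enat" where
  "quot_length R M N =
     Sup {enat n | n L. (\<forall>i\<le>n. submodule (L i) (ring_on R) laurent_module \<and> N \<subseteq> L i \<and> L i \<subseteq> M)
                        \<and> (\<forall>i<n. L i \<subset> L (Suc i))}"


subsection \<open>Local rings\<close>

definition local_ring :: "'k::field fls set \<Rightarrow> bool" where
  "local_ring R \<longleftrightarrow> cring (ring_on R) \<and> (\<exists>!M. maximalideal M (ring_on R))"

definition max_ideal :: "'k::field fls set \<Rightarrow> 'k fls set" where
  "max_ideal R = (THE M. maximalideal M (ring_on R))"

primrec max_ideal_pow :: "'k::field fls set \<Rightarrow> nat \<Rightarrow> 'k fls set" where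
  "max_ideal_pow R 0 = R"
| "max_ideal_pow R (Suc n) = ideal_prod (ring_on R) (max_ideal_pow R n) (max_ideal R)"

text \<open>Separated and complete for the topology defined by the powers of the maximal ideal.\<close>

definition complete_local :: "'k::field fls set \<Rightarrow> bool" where
  "complete_local R \<longleftrightarrow>
     (\<Inter>n. max_ideal_pow R n) = {0} \<and>
     (\<forall>f :: nat \<Rightarrow> 'k fls. range f \<subseteq> R \<longrightarrow>
        (\<forall>n. \<exists>N. \<forall>i\<ge>N. \<forall>j\<ge>N. f i - f j \<in> max_ideal_pow R n) \<longrightarrow>
        (\<exists>g\<in>R. \<forall>n. \<exists>N. \<forall>i\<ge>N. f i - g \<in> max_ideal_pow R n))"

definition krull_dim :: "'k::field fls set \<Rightarrow> enat" where
  "krull_dim R =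
     Sup {enat n | n P. (\<forall>i\<le>n. primeideal (P i) (ring_on R)) \<and> (\<forall>i<n. P i \<subset> P (Suc i))}"

text \<open>For a local ring with residue field \<open>k\<close>.\<close>

definition edim :: "'k::field fls set \<Rightarrow> enat" where
  "edim R = quot_dim (max_ideal R) (max_ideal_pow R 2)"

definition regular_local :: "'k::field fls set \<Rightarrow> bool" where
  "regular_local R \<longleftrightarrow> edim R = krull_dim R"

text \<open>
  The Hilbert--Samuel multiplicity, i.e. the limit of \<open>d! \<ell>(R/m\<^sup>n) / n\<^sup>d\<close> with \<open>d = dim R\<close>,
  for a ring of dimension \<open>d = 1\<close>.
\<close>

definition hs_multiplicity :: "'k::field fls set \<Rightarrow> ereal" where
  "hs_multiplicity R =
     lim (\<lambda>n. ereal_of_enat (quot_length R R (max_ideal_pow R n)) / ereal (real n))"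


subsection \<open>Integral closure and conductor\<close>

definition frac_field :: "'k::field fls set \<Rightarrow> 'k fls set" where
  "frac_field R = {a / b | a b. a \<in> R \<and> b \<in> R \<and> b \<noteq> 0}"

definition int_closure :: "'k::field fls set \<Rightarrow> 'k fls set" where
  "int_closure R =
     {f \<in> frac_field R.
        \<exists>p. Polynomial.lead_coeff p = 1 \<and> (\<forall>i. Polynomial.coeff p i \<in> R) \<and> Polynomial.poly p f = 0}"

definition conductor :: "'k::field fls set \<Rightarrow> 'k fls set" where
  "conductor R = {f \<in> frac_field R. \<forall>g\<in>int_closure R. f * g \<in> R}"


subsection \<open>The class of rings considered\<close>

text \<open>
  A non-regular one-dimensional complete (Noetherian) local domain with residue field \<open>k\<close> that
  is a \<open>k\<close>-algebra and has integral closure \<open>k[[t]]\<close> in its fraction field.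
\<close>

definition branch_ring :: "'k::field fls set \<Rightarrow> bool" where
  "branch_ring R \<longleftrightarrow>
     domain (ring_on R) \<and> noetherian_ring (ring_on R) \<and> local_ring R \<and> complete_local R \<and>
     range fls_const \<subseteq> R \<and> (\<forall>r\<in>R. \<exists>c. r - fls_const c \<in> max_ideal R) \<and>
     krull_dim R = 1 \<and> \<not> regular_local R \<and>
     int_closure R = range fps_to_fls"

text \<open>
  A power series in variables indexed by a finite set \<open>J\<close> is given by its coefficients \<open>c \<alpha>\<close>,
  where \<open>\<alpha>\<close> ranges over the exponents with support in \<open>J\<close>.  The metric of the type of
  formal Laurent series is the \<open>t\<close>-adic one.
\<close>

definition exponents :: "nat set \<Rightarrow> (nat \<Rightarrow> nat) set" where
  "exponents J = {\<alpha>. \<forall>i. i \<notin> J \<longrightarrow> \<alpha> i = 0}"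

definition power_series_value ::
  "nat set \<Rightarrow> (nat \<Rightarrow> 'k::field fls) \<Rightarrow> ((nat \<Rightarrow> nat) \<Rightarrow> 'k) \<Rightarrow> 'k fls \<Rightarrow> bool" where
  "power_series_value J x c f \<longleftrightarrow>
     ((\<lambda>\<alpha>. fls_const (c \<alpha>) * (\<Prod>i\<in>J. x i ^ \<alpha> i)) has_sum f) (exponents J)"

text \<open>The subring \<open>k[[x\<^sub>i | i \<in> J]]\<close>, for \<open>x\<^sub>i\<close> of positive order.\<close>

definition power_series_ring :: "nat set \<Rightarrow> (nat \<Rightarrow> 'k::field fls) \<Rightarrow> 'k fls set" where
  "power_series_ring J x = {f. \<exists>c. power_series_value J x c f}"

text \<open>
  \<open>X\<^sub>i \<mapsto> x\<^sub>i\<close> defines an isomorphism of \<open>R\<close> with \<open>k[[X\<^sub>1, \<dots>, X\<^sub>n]]/I\<close>, where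
  \<open>I \<subseteq> (X\<^sub>1, \<dots>, X\<^sub>n)\<^sup>2\<close>, that is, the elements of \<open>I\<close> have no terms of degree less than 2.
\<close>

definition presentation :: "'k::field fls set \<Rightarrow> nat \<Rightarrow> (nat \<Rightarrow> 'k fls) \<Rightarrow> bool" where
  "presentation R n x \<longleftrightarrow>
     (\<forall>i\<in>{1..n}. x i \<in> max_ideal R) \<and>
     R = power_series_ring {1..n} x \<and>
     (\<forall>c. power_series_value {1..n} x c 0 \<longrightarrow>
        (\<forall>\<alpha>\<in>exponents {1..n}. (\<Sum>i\<in>{1..n}. \<alpha> i) < 2 \<longrightarrow> c \<alpha> = 0))"


subsection \<open>Semigroups and semigroup rings\<close>

definition val_semigroup :: "'k::field fls set \<Rightarrow> nat set" where
  "val_semigroup R = {v. \<exists>r\<in>R. r \<noteq> 0 \<and> fls_subdegree r = int v}"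

inductive_set submonoid_gen :: "nat set \<Rightarrow> nat set" for B where
  zero: "0 \<in> submonoid_gen B"
| add: "b \<in> B \<Longrightarrow> h \<in> submonoid_gen B \<Longrightarrow> b + h \<in> submonoid_gen B"

text \<open>A submonoid of the natural numbers has exactly one minimal generating set.\<close>

definition min_gens :: "nat set \<Rightarrow> nat set" where
  "min_gens H = (THE B. submonoid_gen B = H \<and> (\<forall>B'. B' \<subset> B \<longrightarrow> submonoid_gen B' \<noteq> H))"

definition semigroup_ring :: "nat set \<Rightarrow> 'k::field fls set" where
  "semigroup_ring H = power_series_ring (min_gens H) (\<lambda>b. fls_X ^ b)"


subsection \<open>Type and reduced type\<close>

text \<open>
  The parameter \<open>x\<^sub>1\<close> below is the element of least order in the chosen system of generators
  of the maximal ideal.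
\<close>

definition principal :: "'k::field fls set \<Rightarrow> 'k fls \<Rightarrow> 'k fls set" where
  "principal R x1 = {x1 * r | r. r \<in> R}"

definition reduced_type :: "'k::field fls set \<Rightarrow> 'k fls \<Rightarrow> enat" where
  "reduced_type R x1 =
     quot_dim {f + g | f g. f \<in> conductor R \<and> g \<in> principal R x1} (principal R x1)"

definition cm_type :: "'k::field fls set \<Rightarrow> 'k fls \<Rightarrow> enat" where
  "cm_type R x1 =
     quot_dim {r \<in> R. \<forall>y\<in>max_ideal R. r * y \<in> principal R x1} (principal R x1)"

definition maximal_reduced_type :: "'k::field fls set \<Rightarrow> 'k fls \<Rightarrow> bool" where
  "maximal_reduced_type R x1 \<longleftrightarrow> reduced_type R x1 = cm_type R x1"

definition minimal_reduced_type :: "'k::field fls set \<Rightarrow> 'k fls \<Rightarrow> bool" where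
  "minimal_reduced_type R x1 \<longleftrightarrow> reduced_type R x1 = 1"

definition minimal_multiplicity :: "'k::field fls set \<Rightarrow> bool" where
  "minimal_multiplicity R \<longleftrightarrow> ereal_of_enat (edim R) = hs_multiplicity R"

definition almost_Gorenstein :: "'k::field fls set \<Rightarrow> 'k fls \<Rightarrow> bool" where
  "almost_Gorenstein R x1 \<longleftrightarrow>
     quot_length R (int_closure R) R = quot_length R R (conductor R) + cm_type R x1 - 1"

end

theory Submission
  imports Defs
begin

text \<open>
  For subspaces \<open>B \<subseteq> A\<close> of \<open>k[[t]]\<close> that agree in high orders, \<open>dim A/B\<close> is the number of values of \<open>A\<close>
  that are not values of \<open>B\<close>.  Write \<open>H = v(R)\<close>, let \<open>c\<close> be the conductor of \<open>H\<close> and \<open>e = a\<^sub>1\<close> its least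
  positive element.  The conductor of \<open>R\<close> is \<open>t\<^sup>ck[[t]]\<close>, so \<open>s(R)\<close> counts the elements of \<open>[c, \<infinity>)\<close> outside
  \<open>e + H\<close> and depends on \<open>H\<close> only.  The values of \<open>x\<^sub>1R : \<mm>\<close> lie in
  \<open>K = {h \<in> H. h + (H - {0}) \<subseteq> e + H}\<close>, with equality for \<open>k[[H]]\<close>; hence
  \<open>type R \<le> type k[[H]] = |K - (e + H)|\<close>, and everything follows once equality of the types is known in the
  last two cases.  Minimal multiplicity gives \<open>\<mm>\<^sup>2 = x\<^sub>1\<mm>\<close>, so that all values in \<open>K\<close> occur.  If \<open>R\<close> is almost
  Gorenstein, \<open>type R\<close> is the number of gaps of \<open>H\<close> minus the number of elements of \<open>H\<close> below \<open>c\<close> plus one,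
  and this is at least \<open>type k[[H]]\<close>, since a pseudo-Frobenius number other than \<open>c - 1\<close> is a gap that is not of
  the form \<open>c - 1 - h\<close> with \<open>h \<in> H\<close>.
\<close>

subsection \<open>Dimensions of quotients and values\<close>

text \<open>The comparison presupposes that \<open>t^N k[[t]]\<close> lies in \<open>R\<close> for
  some \<open>N\<close>. \<open>branch_ring\<close> prescribes the integral closure as a set, and
  its finiteness over \<open>R\<close> is not given in advance, so the tail is constructed:
  \<open>t\<close> is a fraction of elements of \<open>R\<close>, which yields elements of every
  large order, and the presentation makes \<open>R\<close> closed under power series in a generator
  of positive order. The description of the maximal ideal rests on this tail, so it cannot be used
  in its construction. After that, \<open>R\<close> and \<open>k[[H]]\<close> are two instances of
  one locale. The inequality \<open>edim R \<le> e\<close>, which comes from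
  \<open>xm \<subseteq> m^2\<close>, has a second use besides minimal multiplicity: with
  \<open>n \<ge> 2\<close> it excludes \<open>e = 1\<close>, that is, the semigroup of all naturals,
  for which \<open>c = 0\<close> and \<open>c - 1\<close> in the almost Gorenstein count would be
  meaningless.\<close>

notation fls_nth (infixl "$$" 75)

text \<open>This is \<open>t^N k[[t]]\<close>. It is stated with coefficients because
  \<open>fls_subdegree 0 = 0\<close>, so that a bound on the subdegree would misplace the zero
  series.\<close>

definition ordge :: "int \<Rightarrow> 'k::field fls set" where
  "ordge N = {f. \<forall>j<N. f $$ j = 0}"

lemma ordge_iff: "f \<in> ordge N \<longleftrightarrow> f = 0 \<or> N \<le> fls_subdegree f"
  unfolding ordge_def
  by (auto intro: fls_subdegree_geI)

lemma ordgeD: "f \<in> ordge N \<Longrightarrow> j < N \<Longrightarrow> f $$ j = 0"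
  by (simp add: ordge_def)

lemma zero_ordge [simp]: "0 \<in> ordge N"
  by (simp add: ordge_def)

lemma ordge_add: "f \<in> ordge N \<Longrightarrow> g \<in> ordge N \<Longrightarrow> f + g \<in> ordge N"
  by (simp add: ordge_def)

lemma ordge_diff: "f \<in> ordge N \<Longrightarrow> g \<in> ordge N \<Longrightarrow> f - g \<in> ordge N"
  by (simp add: ordge_def)

lemma ordge_mono: "f \<in> ordge N \<Longrightarrow> M \<le> N \<Longrightarrow> f \<in> ordge M"
  by (simp add: ordge_def)

lemma ordge_mult: "f \<in> ordge N \<Longrightarrow> g \<in> ordge M \<Longrightarrow> f * g \<in> ordge (N + M)"
  by (cases "f = 0 \<or> g = 0") (auto simp: ordge_iff)

lemma ordge_mult': "f \<in> ordge N \<Longrightarrow> g \<in> ordge M \<Longrightarrow> L \<le> N + M \<Longrightarrow> f * g \<in> ordge L"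
  by (blast intro: ordge_mult ordge_mono)

lemma const_ordge [simp]: "fls_const c \<in> ordge 0"
  by (simp add: ordge_def)

lemma ordge_const_mult: "f \<in> ordge N \<Longrightarrow> fls_const c * f \<in> ordge N"
  by (rule ordge_mult'[of _ 0 _ N]) auto

lemma ordge_power: "f \<in> ordge N \<Longrightarrow> f ^ n \<in> ordge (int n * N)"
proof (induction n)
  case 0
  then show ?case using const_ordge[of 1] by simp
next
  case (Suc n)
  then show ?case by (auto simp: algebra_simps intro: ordge_mult')
qed

lemma ordge_sum: "(\<And>i. i \<in> I \<Longrightarrow> f i \<in> ordge N) \<Longrightarrow> sum f I \<in> ordge N"
  by (induction I rule: infinite_finite_induct) (auto intro: ordge_add)

lemma ordge_eq0:
  assumes "\<And>M::nat. f \<in> ordge (int M)"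
  shows "f = 0"
proof (rule fls_eqI)
  fix j
  have "j < int (nat (j + 1))" by simp
  then have "f $$ j = 0" by (rule ordgeD[OF assms])
  then show "f $$ j = 0 $$ j" by simp
qed

lemma ordge_div:
  assumes "f \<in> ordge N" "g \<noteq> 0" "M + fls_subdegree g \<le> N"
  shows "f / g \<in> ordge M"
proof (cases "f = 0")
  case False
  then have "fls_subdegree (f / g) + fls_subdegree g = fls_subdegree (f / g * g)"
    using assms(2) by (intro fls_subdegree_mult[symmetric]) auto
  then show ?thesis using assms False by (auto simp: ordge_iff)
qed simp

lemma range_fps_to_fls: "range fps_to_fls = (ordge 0 :: 'k::field fls set)"
proof -
  have "f \<in> range fps_to_fls" if "f \<in> ordge 0" for f :: "'k fls"
  proof -
    have "f = fps_to_fls (fls_regpart f)"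
      using that by (intro fls_eqI) (auto simp: ordge_def)
    then show ?thesis by blast
  qed
  moreover have "range fps_to_fls \<subseteq> (ordge 0 :: 'k fls set)"
    by (auto simp: ordge_def)
  ultimately show ?thesis by blast
qed

text \<open>Suited to sums and differences: both conditions concern coefficients, and the second
  already implies \<open>r \<noteq> 0\<close>.\<close>

lemma val_iff: "v \<in> val_semigroup A \<longleftrightarrow> (\<exists>r\<in>A. r \<in> ordge (int v) \<and> r $$ int v \<noteq> 0)"
proof
  assume "v \<in> val_semigroup A"
  then obtain r where r: "r \<in> A" "r \<noteq> 0" "fls_subdegree r = int v"
    unfolding val_semigroup_def by auto
  then have "r \<in> ordge (int v)" by (simp add: ordge_iff)
  moreover have "r $$ int v \<noteq> 0" using nth_fls_subdegree_nonzero[OF r(2)] r(3) by simp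
  ultimately show "\<exists>r\<in>A. r \<in> ordge (int v) \<and> r $$ int v \<noteq> 0" using r(1) by blast
next
  assume "\<exists>r\<in>A. r \<in> ordge (int v) \<and> r $$ int v \<noteq> 0"
  then obtain r where r: "r \<in> A" "r \<in> ordge (int v)" "r $$ int v \<noteq> 0" by blast
  then have "fls_subdegree r = int v" by (intro fls_subdegree_eqI) (auto simp: ordge_def)
  moreover have "r \<noteq> 0" using r(3) by auto
  ultimately show "v \<in> val_semigroup A" using r(1) unfolding val_semigroup_def by blast
qed

lemma val_mono: "A \<subseteq> B \<Longrightarrow> val_semigroup A \<subseteq> val_semigroup B"
  unfolding val_semigroup_def by blast

section \<open>Subspaces, their values, and dimensions of quotients\<close>

definition kspace :: "'k::field fls set \<Rightarrow> bool" where
  "kspace A \<longleftrightarrow> 0 \<in> A \<and> (\<forall>f\<in>A. \<forall>g\<in>A. f + g \<in> A) \<and> (\<forall>c. \<forall>f\<in>A. fls_const c * f \<in> A)"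

lemma kspaceD:
  assumes "kspace A"
  shows "0 \<in> A" "f \<in> A \<Longrightarrow> g \<in> A \<Longrightarrow> f + g \<in> A" "f \<in> A \<Longrightarrow> fls_const c * f \<in> A"
    "f \<in> A \<Longrightarrow> - f \<in> A" "f \<in> A \<Longrightarrow> g \<in> A \<Longrightarrow> f - g \<in> A"
proof -
  have neg: "- f \<in> A" if "f \<in> A" for f
  proof -
    have "fls_const (-1) * f \<in> A" using assms that unfolding kspace_def by blast
    then show ?thesis by simp
  qed
  show "0 \<in> A" "f \<in> A \<Longrightarrow> g \<in> A \<Longrightarrow> f + g \<in> A" "f \<in> A \<Longrightarrow> fls_const c * f \<in> A"
    using assms unfolding kspace_def by blast+
  show "f \<in> A \<Longrightarrow> - f \<in> A" by (rule neg)
  assume "f \<in> A" "g \<in> A"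
  then have "f + (- g) \<in> A" using assms neg unfolding kspace_def by blast
  then show "f - g \<in> A" by simp
qed

lemma kspace_sum: "kspace A \<Longrightarrow> (\<And>i. i \<in> I \<Longrightarrow> f i \<in> A) \<Longrightarrow> sum f I \<in> A"
  by (induction I rule: infinite_finite_induct) (auto intro: kspaceD)

text \<open>Finite-dimensional quotients of spaces of power series; the truncation bound replaces
  finiteness of the dimension.\<close>

locale finite_codim =
  fixes A B :: "'k::field fls set"
  assumes A: "kspace A" and B: "kspace B" and sub: "B \<subseteq> A" and A0: "A \<subseteq> ordge 0"
    and trunc: "\<exists>N::nat. A \<inter> ordge (int N) \<subseteq> B"
begin

lemma finite_vals: "finite (val_semigroup A - val_semigroup B)"
proof -
  obtain N :: nat where N: "A \<inter> ordge (int N) \<subseteq> B" using trunc by blast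
  have "val_semigroup A - val_semigroup B \<subseteq> {..<N}"
  proof (intro subsetI)
    fix v assume v: "v \<in> val_semigroup A - val_semigroup B"
    then obtain r where "r \<in> A" "r \<in> ordge (int v)" "r $$ int v \<noteq> 0" by (auto simp: val_iff)
    moreover have "r \<notin> B" using v calculation by (auto simp: val_iff)
    ultimately show "v \<in> {..<N}" using N by (auto dest: ordge_mono[of _ _ "int N"] simp: not_le[symmetric])
  qed
  then show ?thesis by (rule finite_subset) simp
qed

text \<open>Leading terms are cancelled one at a time: the order of \<open>f\<close> is a value of
  \<open>B\<close>, so subtracting a multiple of an element of \<open>B\<close> raises it, until the
  bound of \<open>trunc\<close> is reached.\<close>

lemma eq_of_vals:
  assumes "val_semigroup A \<subseteq> val_semigroup B"
  shows "A = B"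
proof -
  obtain N :: nat where N: "A \<inter> ordge (int N) \<subseteq> B" using trunc by blast
  \<comment> \<open>\<open>j\<close> counts the orders still to be cleared below \<open>N\<close>;
    order 0 corresponds to \<open>j = N\<close>.\<close>
  have *: "f \<in> B" if "f \<in> A" "f \<in> ordge (int N - int j)" for j f
    using that
  proof (induction j arbitrary: f)
    case 0
    then show ?case using N by auto
  next
    case (Suc j)
    let ?v = "int N - int (Suc j)"
    show ?case
    proof (cases "f $$ ?v = 0")
      case True
      then have "f \<in> ordge (int N - int j)" using Suc.prems(2)
      proof -
        have "f $$ i = 0" if "i < int N - int j" for i
          using that True ordgeD[OF Suc.prems(2), of i] by (cases "i = ?v") auto
        then show ?thesis by (simp add: ordge_def)
      qed
      then show ?thesis using Suc by blast
    next
      case False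
      then have v0: "?v \<ge> 0" using A0 Suc.prems(1) unfolding ordge_def
        by (metis (mono_tags, lifting) linorder_not_less mem_Collect_eq subset_iff)
      then have nv: "int (nat ?v) = ?v" by simp
      have "nat ?v \<in> val_semigroup A"
        unfolding val_iff nv using Suc.prems False by blast
      then have "nat ?v \<in> val_semigroup B" using assms by blast
      then obtain b where b: "b \<in> B" "b \<in> ordge ?v" "b $$ ?v \<noteq> 0"
        unfolding val_iff nv by blast
      define g where "g = f - fls_const (f $$ ?v / b $$ ?v) * b"
      have "g \<in> A" unfolding g_def using A B b sub Suc.prems(1) by (blast intro: kspaceD)
      moreover have "g \<in> ordge (int N - int j)"
      proof -
        have "g $$ i = 0" if "i < int N - int j" for i
        proof (cases "i = ?v")
          case True
          then show ?thesis using b by (simp add: g_def)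
        next
          case False
          then have "i < ?v" using that by simp
          then show ?thesis using Suc.prems(2) b by (simp add: g_def ordgeD)
        qed
        then show ?thesis by (simp add: ordge_def)
      qed
      ultimately have "g \<in> B" by (rule Suc.IH)
      moreover have "f = g + fls_const (f $$ ?v / b $$ ?v) * b" by (simp add: g_def)
      ultimately show ?thesis using b(1) B by (metis kspaceD(2) kspaceD(3))
    qed
  qed
  have "f \<in> B" if "f \<in> A" for f using *[of f N] that A0 by auto
  then show ?thesis using sub by blast
qed

end

text \<open>Enlarging \<open>B\<close> by one vector costs at most one independent vector: a
  relation that is new modulo \<open>B + k w\<close> must involve \<open>w\<close>, and discarding
  one member \<open>s0\<close> of it restores independence.\<close>

lemma lin_indep_exchange:
  fixes w :: "'a::field fls"
  assumes B: "kspace B" and S: "finite S" "lin_indep_mod B S"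
  shows "\<exists>S'\<subseteq>S. card S \<le> Suc (card S') \<and> lin_indep_mod {b + fls_const c * w | b c. b \<in> B} S'"
proof (cases "lin_indep_mod {b + fls_const c * w | b c. b \<in> B} S")
  case True
  then show ?thesis by auto
next
  case False
  then obtain c s0 b l where c: "(\<Sum>s\<in>S. fls_const (c s) * s) = b + fls_const l * w" "b \<in> B"
    "s0 \<in> S" "c s0 \<noteq> 0"
    unfolding lin_indep_mod_def by blast
  have l: "l \<noteq> 0"
  proof
    assume "l = 0"
    then have "(\<Sum>s\<in>S. fls_const (c s) * s) \<in> B" using c by simp
    then show False using S c unfolding lin_indep_mod_def by blast
  qed
  have "lin_indep_mod {b + fls_const c * w | b c. b \<in> B} (S - {s0})"
    unfolding lin_indep_mod_def
  proof (intro allI impI)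
    fix d assume "(\<Sum>s\<in>S-{s0}. fls_const (d s) * s) \<in> {b + fls_const c * w | b c. b \<in> B}"
    then obtain b' m where d: "(\<Sum>s\<in>S-{s0}. fls_const (d s) * s) = b' + fls_const m * w" "b' \<in> B" by blast
    \<comment> \<open>The relation \<open>d\<close> minus \<open>m / l\<close> times the relation
      \<open>c\<close>, so that \<open>w\<close> cancels. Its coefficient at \<open>s0\<close> is
      \<open>- m / l * c s0\<close>, and its vanishing forces \<open>m = 0\<close>.\<close>
    define e where "e s = (if s = s0 then 0 else d s) - m / l * c s" for s
    have "(\<Sum>s\<in>S. fls_const (e s) * s) =
        (\<Sum>s\<in>S. fls_const (if s = s0 then 0 else d s) * s) - fls_const (m / l) * (\<Sum>s\<in>S. fls_const (c s) * s)"
    proof -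
      have const: "fls_const (x - y * z) * f = fls_const x * f - fls_const y * (fls_const z * f)" for x y z and f :: "'a fls"
      proof -
        have "fls_const (x - y * z) = fls_const x - fls_const y * fls_const z" by (simp add: fls_minus_const)
        then show ?thesis by (simp only: left_diff_distrib mult.assoc)
      qed
      show ?thesis unfolding e_def const sum_distrib_left sum_subtractf ..
    qed
    also have "(\<Sum>s\<in>S. fls_const (if s = s0 then 0 else d s) * s) = (\<Sum>s\<in>S-{s0}. fls_const (d s) * s)"
      using S(1) c(3) by (subst sum.remove[of _ s0]) (auto intro!: sum.cong)
    also have "\<dots> - fls_const (m / l) * (\<Sum>s\<in>S. fls_const (c s) * s) = b' - fls_const (m / l) * b + (fls_const m - fls_const (m / l) * fls_const l) * w"
      by (simp only: d c) (simp add: algebra_simps)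
    also have "\<dots> = b' - fls_const (m / l) * b" using l by simp
    also have "\<dots> \<in> B" using B c d by (blast intro: kspaceD)
    finally have e: "\<forall>s\<in>S. e s = 0" using S unfolding lin_indep_mod_def by blast
    then have "m / l * c s0 = 0" using c(3) unfolding e_def by fastforce
    then have "m = 0" using c(4) l by simp
    show "\<forall>s\<in>S-{s0}. d s = 0"
    proof
      fix s assume "s \<in> S - {s0}"
      then show "d s = 0" using e \<open>m = 0\<close> by (auto simp: e_def)
    qed
  qed
  moreover have "Suc (card (S - {s0})) = card S"
    by (rule card_Suc_Diff1[OF S(1) c(3)])
  then have "card S \<le> Suc (card (S - {s0}))" by simp
  ultimately show ?thesis by (intro exI[of _ "S - {s0}"] conjI) auto
qed

text \<open>Leading terms of \<open>b\<close> and of a multiple of \<open>w\<close> cancel only if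
  \<open>b\<close> has order \<open>v\<close>, which is not a value of \<open>B\<close>; hence
  exactly one value is created.\<close>

lemma (in finite_codim) extend_by_element:
  assumes w: "w \<in> A" "w \<in> ordge (int v)" "w $$ int v \<noteq> 0" and v: "v \<notin> val_semigroup B"
  defines "B' \<equiv> {b + fls_const c * w | b c. b \<in> B}"
  shows "finite_codim A B'" "val_semigroup B' = insert v (val_semigroup B)"
proof -
  have BB': "B \<subseteq> B'"
  proof
    fix b assume "b \<in> B"
    then have "b = b + fls_const 0 * w \<and> b \<in> B" by simp
    then show "b \<in> B'" unfolding B'_def by blast
  qed
  have "w = 0 + fls_const 1 * w \<and> 0 \<in> B" using B by (simp add: kspaceD)
  then have wB': "w \<in> B'" unfolding B'_def by blast
  show "finite_codim A B'"
  proof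
    show "kspace A" "A \<subseteq> ordge 0" by (fact A A0)+
    show "kspace B'" unfolding kspace_def
    proof (intro conjI allI ballI)
      show "0 \<in> B'" using BB' B kspaceD(1) by blast
      fix f g c assume f: "f \<in> B'"
      then obtain b1 c1 where 1: "f = b1 + fls_const c1 * w" "b1 \<in> B" unfolding B'_def by blast
      have "fls_const c * f = fls_const c * b1 + fls_const (c * c1) * w"
        by (simp only: 1 distrib_left mult.assoc flip: fls_const_mult_const)
      moreover have "fls_const c * b1 \<in> B" using B 1 by (simp add: kspaceD)
      ultimately show "fls_const c * f \<in> B'" unfolding B'_def by blast
      assume "g \<in> B'"
      then obtain b2 c2 where 2: "g = b2 + fls_const c2 * w" "b2 \<in> B" unfolding B'_def by blast
      have "f + g = (b1 + b2) + fls_const (c1 + c2) * w"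
        by (simp add: 1 2 distrib_right flip: fls_plus_const)
      moreover have "b1 + b2 \<in> B" using B 1 2 by (simp add: kspaceD)
      ultimately show "f + g \<in> B'" unfolding B'_def by blast
    qed
    show "B' \<subseteq> A" unfolding B'_def using kspaceD(2,3)[OF A] sub w by blast
    show "\<exists>N::nat. A \<inter> ordge (int N) \<subseteq> B'" using trunc BB' by blast
  qed
  show "val_semigroup B' = insert v (val_semigroup B)"
  proof
    show "insert v (val_semigroup B) \<subseteq> val_semigroup B'"
      using val_mono[OF BB'] wB' w by (auto simp: val_iff)
    show "val_semigroup B' \<subseteq> insert v (val_semigroup B)"
    proof
      fix u assume "u \<in> val_semigroup B'"
      then obtain b c where r: "b \<in> B" "b + fls_const c * w \<in> ordge (int u)"
        "(b + fls_const c * w) $$ int u \<noteq> 0"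
        unfolding val_iff B'_def by blast
      consider "u < v" | "u = v" | "u > v" by linarith
      then show "u \<in> insert v (val_semigroup B)"
      proof cases
        case 1
        have "b \<in> ordge (int u)" "b $$ int u \<noteq> 0"
          using r(2,3) w(2) 1 by (auto simp: ordge_def)
        then show ?thesis using r(1) val_iff by blast
      next
        case 3
        have "c = 0"
        proof (rule ccontr)
          assume "c \<noteq> 0"
          have b: "b = (b + fls_const c * w) - fls_const c * w" by simp
          have "b \<in> ordge (int v)"
            by (subst b, intro ordge_diff ordge_const_mult w(2) ordge_mono[OF r(2)]) (use 3 in simp)
          moreover have "(b + fls_const c * w) $$ int v = 0"
            using ordgeD[OF r(2), of "int v"] 3 by simp
          then have "b $$ int v = - (c * w $$ int v)" by (simp add: eq_neg_iff_add_eq_0)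
          then have "b $$ int v \<noteq> 0" using w(3) \<open>c \<noteq> 0\<close> by simp
          ultimately show False using r(1) v val_iff by blast
        qed
        then show ?thesis using r by (auto simp: val_iff)
      qed auto
    qed
  qed
qed

text \<open>Induction on the number of missing values: a vector realising one of them is added to
  \<open>B\<close>, and the exchange lemma loses at most one member of \<open>S\<close>.\<close>

lemma (in finite_codim) card_indep_le:
  assumes "finite S" "S \<subseteq> A" "lin_indep_mod B S"
  shows "card S \<le> card (val_semigroup A - val_semigroup B)"
  using finite_codim_axioms assms
proof (induction "card (val_semigroup A - val_semigroup B)" arbitrary: B S)
  case 0
  then interpret finite_codim A B by simp
  have "val_semigroup A \<subseteq> val_semigroup B" using 0(1) finite_vals by simp
  then have AB: "A = B" by (rule eq_of_vals)
  have "S = {}"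
  proof (rule ccontr)
    assume "S \<noteq> {}"
    then obtain s where s: "s \<in> S" by blast
    have "(\<Sum>r\<in>S. fls_const 1 * r) \<in> B" using 0(4) AB A by (auto intro!: kspace_sum)
    then have "(1::'k) = 0" using 0(5)[unfolded lin_indep_mod_def, rule_format, of "\<lambda>_. 1" s] s by blast
    then show False by simp
  qed
  then show ?case by simp
next
  case (Suc d)
  interpret finite_codim A B by fact
  have "val_semigroup A - val_semigroup B \<noteq> {}" using Suc.hyps(2) by force
  then obtain v where v: "v \<in> val_semigroup A - val_semigroup B" by blast
  then obtain w where w: "w \<in> A" "w \<in> ordge (int v)" "w $$ int v \<noteq> 0" by (auto simp: val_iff)
  let ?B = "{b + fls_const c * w | b c. b \<in> B}"
  note * = extend_by_element[OF w, of] v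
  obtain S' where S': "S' \<subseteq> S" "card S \<le> Suc (card S')" "lin_indep_mod ?B S'"
    using lin_indep_exchange[OF B Suc.prems(2,4)] by blast
  have "val_semigroup A - val_semigroup ?B = (val_semigroup A - val_semigroup B) - {v}"
    using * by auto
  then have "d = card (val_semigroup A - val_semigroup ?B)" using v Suc.hyps(2) finite_vals
    by (metis card_Diff_singleton diff_Suc_1)
  from Suc.hyps(1)[OF this _ _ _ S'(3)] have "card S' \<le> card (val_semigroup A - val_semigroup ?B)"
    using * S'(1) Suc.prems(2,3) finite_subset by blast
  then show ?case using S'(2) \<open>d = _\<close> Suc.hyps(2) by simp
qed

text \<open>For the lower bound one element of \<open>A\<close> is chosen for each missing value;
  having distinct orders outside the values of \<open>B\<close>, they are independent modulo
  \<open>B\<close>.\<close>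

lemma (in finite_codim) quot_dim_eq:
  "quot_dim A B = enat (card (val_semigroup A - val_semigroup B))"
proof (rule antisym)
  show "quot_dim A B \<le> enat (card (val_semigroup A - val_semigroup B))"
    unfolding quot_dim_def by (rule Sup_least) (auto simp: card_indep_le)
  define D where "D = val_semigroup A - val_semigroup B"
  have "\<forall>v\<in>D. \<exists>r. r \<in> A \<and> r \<in> ordge (int v) \<and> r $$ int v \<noteq> 0" unfolding D_def by (auto simp: val_iff)
  then obtain r where r: "\<And>v. v \<in> D \<Longrightarrow> r v \<in> A \<and> r v \<in> ordge (int v) \<and> r v $$ int v \<noteq> 0" by metis
  have inj: "inj_on r D"
  proof (rule linorder_inj_onI')
    fix u v assume "u \<in> D" "v \<in> D" "u < v"
    then show "r u \<noteq> r v" using r[of u] r[of v] by (metis ordgeD of_nat_less_iff)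
  qed
  have "lin_indep_mod B (r ` D)" unfolding lin_indep_mod_def
  proof (intro allI impI)
    fix c assume "(\<Sum>s\<in>r ` D. fls_const (c s) * s) \<in> B"
    then have s: "(\<Sum>v\<in>D. fls_const (c (r v)) * r v) \<in> B" (is "?s \<in> B")
      using inj by (simp add: sum.reindex)
    \<comment> \<open>Smaller values first: once their coefficients vanish, a nonzero coefficient at
      \<open>r v\<close> would make \<open>v\<close> the order of an element of
      \<open>B\<close>.\<close>
    have "c (r v) = 0" if "v \<in> D" for v
      using that
    proof (induction v rule: less_induct)
      case (less v)
      have fin: "finite D" unfolding D_def by (rule finite_vals)
      have coef: "c (r u) * r u $$ j = 0" if "u \<in> D" "j < int v \<or> j = int v \<and> u \<noteq> v" for u j
      proof (cases "u < v")
        case True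
        then show ?thesis using less.IH that by simp
      next
        case False
        then have "j < int u" using that by auto
        then have "r u $$ j = 0" using r[OF that(1)] ordgeD by blast
        then show ?thesis by simp
      qed
      have nth: "?s $$ j = (\<Sum>u\<in>D. c (r u) * r u $$ j)" for j
        by (induction D rule: infinite_finite_induct) auto
      have "?s \<in> ordge (int v)" unfolding ordge_def nth mem_Collect_eq using coef by (blast intro: sum.neutral)
      moreover have "?s $$ int v = c (r v) * r v $$ int v"
      proof -
        have "(\<Sum>u\<in>D - {v}. c (r u) * r u $$ int v) = 0"
          using coef by (blast intro: sum.neutral)
        then show ?thesis unfolding nth by (simp only: sum.remove[OF fin less.prems] add_0_right)
      qed
      ultimately have "c (r v) \<noteq> 0 \<Longrightarrow> v \<in> val_semigroup B"
        unfolding val_iff using s r[OF less.prems] by (intro bexI[of _ ?s]) auto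
      then show ?case using less.prems unfolding D_def by auto
    qed
    then show "\<forall>s\<in>r ` D. c s = 0" by blast
  qed
  moreover have "r ` D \<subseteq> A" "finite (r ` D)" using r finite_vals unfolding D_def by auto
  moreover have "card (r ` D) = card D" using inj by (rule card_image)
  ultimately show "enat (card (val_semigroup A - val_semigroup B)) \<le> quot_dim A B"
    unfolding quot_dim_def D_def[symmetric] by (intro Sup_upper) (auto, metis)
qed

subsection \<open>Finite-colength subrings of the power series ring\<close>

text \<open>The record-based notion also asks for additive inverses; \<open>-1 \<in> A\<close> turns
  them into scalar multiples.\<close>

lemma submodule_iff:
  assumes "-1 \<in> A"
  shows "submodule L (ring_on A) laurent_module \<longleftrightarrow>
    0 \<in> L \<and> (\<forall>f\<in>L. \<forall>g\<in>L. f + g \<in> L) \<and> (\<forall>r\<in>A. \<forall>f\<in>L. r * f \<in> L)"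
proof
  assume "submodule L (ring_on A) laurent_module"
  then have L: "subgroup L (add_monoid laurent_module)" "submodule_axioms L (ring_on A) laurent_module"
    by (simp_all add: submodule_def)
  show "0 \<in> L \<and> (\<forall>f\<in>L. \<forall>g\<in>L. f + g \<in> L) \<and> (\<forall>r\<in>A. \<forall>f\<in>L. r * f \<in> L)"
    using subgroup.one_closed[OF L(1)] subgroup.m_closed[OF L(1)] L(2)
    by (simp add: laurent_module_def submodule_axioms_def ring_on_def)
next
  assume L: "0 \<in> L \<and> (\<forall>f\<in>L. \<forall>g\<in>L. f + g \<in> L) \<and> (\<forall>r\<in>A. \<forall>f\<in>L. r * f \<in> L)"
  have grp: "group (add_monoid (laurent_module :: ('a fls, 'a fls) module))"
    by (rule groupI) (auto simp: laurent_module_def add.assoc intro: exI[of _ "- x" for x] left_minus)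
  have inv: "m_inv (add_monoid laurent_module) f = - f" for f :: "'a fls"
    by (rule group.inv_equality[OF grp]) (auto simp: laurent_module_def)
  have neg: "- f \<in> L" if "f \<in> L" for f
    using L assms that by (metis mult_minus1)
  show "submodule L (ring_on A) laurent_module"
    unfolding submodule_def submodule_axioms_def
    using L neg by (intro conjI subgroup.intro) (auto simp: inv, auto simp: laurent_module_def ring_on_def)
qed

text \<open>The common setting of \<open>R\<close> and \<open>k[[H]]\<close>. The axiom
  \<open>tail\<close> amounts to a nonzero conductor; it is the source of units, of the fraction
  field and of the integral closure.\<close>

locale val_ring =
  fixes A :: "'k::field fls set"
  assumes nonneg: "A \<subseteq> ordge 0"
    and const: "fls_const c \<in> A"
    and add: "f \<in> A \<Longrightarrow> g \<in> A \<Longrightarrow> f + g \<in> A"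
    and mult: "f \<in> A \<Longrightarrow> g \<in> A \<Longrightarrow> f * g \<in> A"
    and tail: "\<exists>N::nat. ordge (int N) \<subseteq> A"
begin

lemma zero_one: "0 \<in> A" "1 \<in> A" "-1 \<in> A"
  using const[of 0] const[of 1] const[of "-1"] by auto

lemma kspace: "kspace A"
  unfolding kspace_def using zero_one const add mult by blast

lemma power: "f \<in> A \<Longrightarrow> f ^ n \<in> A"
  by (induction n) (auto intro: zero_one mult)

lemma uminus: "f \<in> A \<Longrightarrow> - f \<in> A"
  using kspaceD(4)[OF kspace] by blast

lemma cring: "cring (ring_on A)"
proof (rule cringI)
  show "abelian_group (ring_on A)"
    by (rule abelian_groupI) (auto simp: ring_on_def add zero_one add.assoc add.commute intro: bexI[of _ "- x" for x] uminus)
  show "comm_monoid (ring_on A)"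
    by (rule comm_monoidI) (auto simp: ring_on_def mult zero_one mult.assoc mult.commute)
qed (auto simp: ring_on_def distrib_right)

lemma ideal_iff:
  "ideal I (ring_on A) \<longleftrightarrow> I \<subseteq> A \<and> 0 \<in> I \<and> (\<forall>f\<in>I. \<forall>g\<in>I. f + g \<in> I) \<and> (\<forall>r\<in>A. \<forall>f\<in>I. r * f \<in> I)"
proof
  assume I: "ideal I (ring_on A)"
  then have s: "additive_subgroup I (ring_on A)" by (simp add: ideal_def)
  show "I \<subseteq> A \<and> 0 \<in> I \<and> (\<forall>f\<in>I. \<forall>g\<in>I. f + g \<in> I) \<and> (\<forall>r\<in>A. \<forall>f\<in>I. r * f \<in> I)"
    using additive_subgroup.zero_closed[OF s] additive_subgroup.a_closed[OF s]
      additive_subgroup.a_subset[OF s] ideal.I_l_closed[OF I]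
    by (auto simp: ring_on_def)
next
  assume I: "I \<subseteq> A \<and> 0 \<in> I \<and> (\<forall>f\<in>I. \<forall>g\<in>I. f + g \<in> I) \<and> (\<forall>r\<in>A. \<forall>f\<in>I. r * f \<in> I)"
  have ring: "ring (ring_on A)" using cring by (rule cring.axioms)
  have grp: "group (add_monoid (ring_on A))"
    using ring by (intro abelian_group.a_group ring.is_abelian_group)
  have inv: "m_inv (add_monoid (ring_on A)) f = - f" if "f \<in> A" for f
    by (rule group.inv_equality[OF grp]) (auto simp: ring_on_def that uminus)
  have neg: "- f \<in> I" if "f \<in> I" for f
    using I zero_one(3) that by (metis mult_minus1)
  have mult_right: "f * r \<in> I" if "f \<in> I" "r \<in> A" for f r
    using I that by (subst mult.commute) blast
  show "ideal I (ring_on A)"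
  proof (rule idealI[OF ring])
    show "subgroup I (add_monoid (ring_on A))"
    proof (rule subgroup.intro)
      fix f assume f: "f \<in> I"
      then have "f \<in> A" using I by blast
      show "m_inv (add_monoid (ring_on A)) f \<in> I"
        unfolding inv[OF \<open>f \<in> A\<close>] using f by (rule neg)
    qed (use I in \<open>auto simp: ring_on_def\<close>)
  qed (use I mult_right in \<open>auto simp: ring_on_def\<close>)
qed

text \<open>Up to a constant, \<open>f\<close> is \<open>1 - g\<close> with \<open>g\<close> of
  positive order, so its inverse is a truncated geometric series plus \<open>g ^ N / f\<close>, and
  this remainder has order at least \<open>N\<close>.\<close>

lemma inverse_closed:
  assumes "f \<in> A" "f $$ 0 \<noteq> 0"
  shows "inverse f \<in> A"
proof -
  obtain N :: nat where N: "ordge (int N) \<subseteq> A" using tail by blast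
  define g where "g = 1 - fls_const (inverse (f $$ 0)) * f"
  have g: "g \<in> A" unfolding g_def using kspaceD(3,5)[OF kspace] zero_one assms by blast
  have f0: "f \<noteq> 0" "fls_subdegree f = 0"
    using assms nonneg by (auto simp: ordge_def intro!: fls_subdegree_eqI)
  have "g \<in> ordge 1" unfolding ordge_def
  proof (intro CollectI allI impI)
    fix j :: int assume "j < 1"
    then consider "j < 0" | "j = 0" by linarith
    then show "g $$ j = 0"
      using assms nonneg by cases (auto simp: g_def ordge_def)
  qed
  then have "g ^ N \<in> ordge (int N)" using ordge_power[of g 1 N] by simp
  then have "g ^ N / f \<in> A" using ordge_div[of "g ^ N" "int N" f "int N"] N f0 by auto
  moreover have "(1 - g) * (\<Sum>i<N. g ^ i) = 1 - g ^ N" by (rule one_diff_power_eq[symmetric])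
  then have "fls_const (inverse (f $$ 0)) * f * (\<Sum>i<N. g ^ i) = 1 - g ^ N" by (simp add: g_def)
  then have "inverse f = fls_const (inverse (f $$ 0)) * (\<Sum>i<N. g ^ i) + g ^ N / f"
    using f0 by (simp add: field_simps)
  moreover have "(\<Sum>i<N. g ^ i) \<in> A" by (intro kspace_sum kspace power g)
  ultimately show ?thesis by (simp add: add const mult)
qed

text \<open>Elements with nonzero constant term are units, so an ideal not inside
  \<open>A \<inter> ordge 1\<close> is all of \<open>A\<close>. The resulting uniqueness evaluates
  the definite description in \<open>max_ideal\<close>.\<close>

lemma max_ideal_eq: "max_ideal A = A \<inter> ordge 1"
proof -
  let ?M = "A \<inter> ordge 1"
  have M: "ideal ?M (ring_on A)" unfolding ideal_iff
  proof (intro conjI ballI)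
    fix r f assume "r \<in> A" "f \<in> ?M"
    then show "r * f \<in> ?M" using nonneg mult by (auto intro: ordge_mult'[of r 0 f 1])
  qed (auto simp: zero_one add ordge_add)
  have big: "I = A" if I: "ideal I (ring_on A)" "\<not> I \<subseteq> ?M" for I
  proof -
    have IA: "I \<subseteq> A" using I by (simp add: ideal_iff)
    then obtain f where f: "f \<in> I" "f \<in> A" "f \<notin> ordge 1" using I(2) by blast
    then obtain j where "j < 1" "f $$ j \<noteq> 0" by (auto simp: ordge_def)
    moreover have "f $$ i = 0" if "i < 0" for i using nonneg f(2) that by (auto simp: ordge_def)
    ultimately have f0: "f $$ 0 \<noteq> 0" by (metis int_one_le_iff_zero_less linorder_neqE_linordered_idom linorder_not_le)
    then have "f \<noteq> 0" by auto
    have "r \<in> I" if "r \<in> A" for r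
    proof -
      have "r * inverse f \<in> A" using that f(2) f0 inverse_closed mult by blast
      then have "r * inverse f * f \<in> I" using I(1) f(1) unfolding ideal_iff by blast
      then show ?thesis using \<open>f \<noteq> 0\<close> by (simp add: mult.assoc)
    qed
    then show ?thesis using IA by blast
  qed
  have "(1 :: 'k fls) \<notin> ordge 1" by (auto simp: ordge_iff)
  then have ne: "?M \<noteq> A" using zero_one(2) by blast
  show ?thesis unfolding max_ideal_def
  proof (rule the_equality)
    show "maximalideal ?M (ring_on A)"
      by (rule maximalidealI[OF M]) (use ne big in \<open>auto simp: ring_on_def\<close>)
    fix I assume I: "maximalideal I (ring_on A)"
    then have id: "ideal I (ring_on A)" by (simp add: maximalideal_def)
    have "I \<noteq> A" using maximalideal.I_notcarr[OF I] by (simp add: ring_on_def)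
    then have "I \<subseteq> ?M" using big[OF id] by blast
    then show "I = ?M" using maximalideal.I_maximal[OF I M] ne by (auto simp: ring_on_def)
  qed
qed

lemma frac_field_eq: "frac_field A = UNIV"
proof -
  obtain N :: nat where N: "ordge (int N) \<subseteq> A" using tail by blast
  have "f \<in> frac_field A" for f
  proof -
    \<comment> \<open>Large enough that both \<open>t^M\<close> and \<open>f t^M\<close> have order
      at least \<open>N\<close>.\<close>
    define M where "M = N + nat (- fls_subdegree f)"
    have X: "(fls_X :: 'k fls) ^ M \<in> ordge (int M)" by (auto simp: ordge_def)
    then have "(fls_X :: 'k fls) ^ M \<in> ordge (int N)" by (rule ordge_mono) (simp add: M_def)
    then have "(fls_X :: 'k fls) ^ M \<in> A" using N by blast
    moreover have "f \<in> ordge (fls_subdegree f)" by (simp add: ordge_iff)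
    then have "f * fls_X ^ M \<in> A"
      using N ordge_mult'[OF _ X, of f "fls_subdegree f" "int N"] by (auto simp: M_def)
    moreover have "f = f * fls_X ^ M / fls_X ^ M"
      by (rule nonzero_mult_div_cancel_right[symmetric]) simp
    ultimately show ?thesis unfolding frac_field_def using fls_X_pow_nonzero by blast
  qed
  then show ?thesis by blast
qed

end

section \<open>Integral closure\<close>

lemma integral_ordge:
  fixes f :: "'k::field fls"
  assumes p: "Polynomial.lead_coeff p = 1" "\<And>i. Polynomial.coeff p i \<in> ordge 0" "Polynomial.poly p f = 0"
  shows "f \<in> ordge 0"
proof (rule ccontr)
  assume f: "f \<notin> ordge 0"
  then have f0: "f \<noteq> 0" by auto
  \<comment> \<open>The order of \<open>f\<close> is negative here. Dividing the integral equation
    by \<open>f ^ m\<close> writes \<open>f\<close> as a polynomial in \<open>inverse f\<close> with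
    coefficients in \<open>k[[t]]\<close>, so \<open>f\<close> would have nonnegative order.\<close>
  have inv: "inverse f \<in> ordge 0" using f by (auto simp: ordge_iff)
  define n where "n = Polynomial.degree p"
  have "n \<noteq> 0"
  proof
    assume "n = 0"
    then obtain a where "p = [:a:]" unfolding n_def by (metis degree_eq_zeroE)
    then show False using p by auto
  qed
  then obtain m where m: "n = Suc m" by (cases n) auto
  have "0 = (\<Sum>i\<le>n. Polynomial.coeff p i * f ^ i)"
    using p(3) by (simp add: poly_altdef n_def)
  also have "\<dots> = (\<Sum>i\<le>m. Polynomial.coeff p i * f ^ i) + f ^ m * f"
    using p(1) by (simp add: m n_def[symmetric] mult.commute)
  finally have *: "f ^ m * f = - (\<Sum>i\<le>m. Polynomial.coeff p i * f ^ i)"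
    by (simp add: eq_neg_iff_add_eq_0 add.commute)
  have "f = inverse f ^ m * (f ^ m * f)" using f0 by (simp add: field_simps)
  also have "\<dots> = - (\<Sum>i\<le>m. Polynomial.coeff p i * inverse f ^ (m - i))"
    unfolding * mult_minus_right sum_distrib_left
  proof (intro arg_cong[of _ _ uminus] sum.cong refl)
    fix i assume "i \<in> {..m}"
    then have "inverse f ^ m = inverse f ^ (m - i) * inverse f ^ i" by (simp flip: power_add)
    then show "inverse f ^ m * (Polynomial.coeff p i * f ^ i) = Polynomial.coeff p i * inverse f ^ (m - i)"
      using f0 by (simp add: field_simps)
  qed
  also have "\<dots> = 0 - (\<Sum>i\<le>m. Polynomial.coeff p i * inverse f ^ (m - i))" by simp
  also have "\<dots> \<in> ordge 0"
  proof (intro ordge_diff ordge_sum zero_ordge)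
    fix i
    show "Polynomial.coeff p i * inverse f ^ (m - i) \<in> ordge 0"
      using ordge_mult[OF p(2), of "inverse f ^ (m - i)" 0 i] ordge_power[OF inv, of "m - i"] by simp
  qed
  finally show False using f by blast
qed

context val_ring
begin

lemma coeff_mult_closed:
  assumes "\<And>i. Polynomial.coeff p i \<in> A" "\<And>i. Polynomial.coeff q i \<in> A"
  shows "Polynomial.coeff (p * q) i \<in> A"
  unfolding coeff_mult by (intro kspace_sum kspace mult assms)

text \<open>A series of positive order has a power in the ring, so it is integral.\<close>

lemma int_closure_eq: "int_closure A = ordge 0"
proof
  show "int_closure A \<subseteq> ordge 0"
    unfolding int_closure_def using integral_ordge nonneg by blast
  show "ordge 0 \<subseteq> int_closure A"
  proof
    fix f :: "'k fls" assume f: "f \<in> ordge 0"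
    obtain N :: nat where N: "ordge (int N) \<subseteq> A" using tail by blast
    \<comment> \<open>\<open>Suc N\<close> keeps the degree positive, so that
      \<open>(Y - f(0))^M - g^M\<close> is monic also for \<open>N = 0\<close>.\<close>
    define M where "M = Suc N"
    define g where "g = f - fls_const (f $$ 0)"
    have "g \<in> ordge 1" unfolding ordge_def
    proof (intro CollectI allI impI)
      fix j :: int assume "j < 1"
      then consider "j < 0" | "j = 0" by linarith
      then show "g $$ j = 0" using f by cases (auto simp: g_def ordge_def)
    qed
    then have "g ^ M \<in> ordge (int M)" using ordge_power[of g 1 M] by simp
    then have "g ^ M \<in> ordge (int N)" by (rule ordge_mono) (simp add: M_def)
    then have gA: "g ^ M \<in> A" using N by blast
    define q where "q = [: - fls_const (f $$ 0), 1 :]"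
    define p where "p = [: - (g ^ M) :] + q ^ M"
    have dq: "Polynomial.degree (q ^ M) = M" unfolding q_def by (rule degree_linear_power)
    have "Polynomial.lead_coeff p = Polynomial.lead_coeff (q ^ M)"
      unfolding p_def
    proof (rule lead_coeff_add_le)
      show "Polynomial.degree [: - (g ^ M) :] < Polynomial.degree (q ^ M)"
        unfolding dq by (simp add: M_def)
    qed
    also have "\<dots> = 1" unfolding lead_coeff_power by (simp add: q_def)
    finally have "Polynomial.lead_coeff p = 1" .
    moreover have "Polynomial.coeff (q ^ M) i \<in> A" for i
    proof (induction M arbitrary: i)
      case 0
      then show ?case by (simp add: zero_one)
    next
      case (Suc M)
      have "Polynomial.coeff q j \<in> A" for j
        by (auto simp: q_def coeff_pCons zero_one uminus const simp del: fls_const_uminus split: nat.split)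
      then show ?case unfolding power_Suc using Suc by (intro coeff_mult_closed) auto
    qed
    then have "Polynomial.coeff p i \<in> A" for i
      unfolding p_def coeff_add by (intro add) (auto simp: coeff_pCons zero_one uminus gA split: nat.split)
    moreover have "Polynomial.poly p f = 0" by (simp add: p_def q_def g_def)
    ultimately show "f \<in> int_closure A" unfolding int_closure_def frac_field_eq by blast
  qed
qed

end

section \<open>Lengths of quotients as numbers of values\<close>

lemma finite_codim_add_tail:
  fixes A B :: "'k::field fls set"
  assumes "finite_codim A B" and h: "h \<in> val_semigroup A - val_semigroup B"
    and max: "\<And>v. v \<in> val_semigroup A - val_semigroup B \<Longrightarrow> v \<le> h"
  defines "B' \<equiv> {b + f | b f. b \<in> B \<and> f \<in> A \<and> f \<in> ordge (int h)}"
  shows "finite_codim A B'" "B \<subseteq> B'" "val_semigroup B' = insert h (val_semigroup B)"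
proof -
  interpret finite_codim A B by fact
  show BB': "B \<subseteq> B'"
  proof
    fix b assume "b \<in> B"
    then have "b = b + 0 \<and> b \<in> B \<and> 0 \<in> A \<and> 0 \<in> ordge (int h)" using kspaceD(1)[OF A] by simp
    then show "b \<in> B'" unfolding B'_def by blast
  qed
  show "finite_codim A B'"
  proof
    show "kspace A" "A \<subseteq> ordge 0" by (fact A A0)+
    show "kspace B'" unfolding kspace_def
    proof (intro conjI allI ballI)
      show "0 \<in> B'" using BB' kspaceD(1)[OF B] by blast
      fix f g c assume f: "f \<in> B'"
      then obtain b1 f1 where 1: "f = b1 + f1" "b1 \<in> B" "f1 \<in> A" "f1 \<in> ordge (int h)" unfolding B'_def by blast
      have "fls_const c * f = fls_const c * b1 + fls_const c * f1" by (simp add: 1 distrib_left)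
      then show "fls_const c * f \<in> B'" unfolding B'_def
        using kspaceD(3)[OF B 1(2)] kspaceD(3)[OF A 1(3)] ordge_const_mult[OF 1(4)] by blast
      assume "g \<in> B'"
      then obtain b2 f2 where 2: "g = b2 + f2" "b2 \<in> B" "f2 \<in> A" "f2 \<in> ordge (int h)" unfolding B'_def by blast
      have "f + g = (b1 + b2) + (f1 + f2)" by (simp add: 1 2)
      then show "f + g \<in> B'" unfolding B'_def
        using kspaceD(2)[OF B 1(2) 2(2)] kspaceD(2)[OF A 1(3) 2(3)] ordge_add[OF 1(4) 2(4)] by blast
    qed
    show "B' \<subseteq> A" unfolding B'_def using kspaceD(2)[OF A] sub by blast
    show "\<exists>N::nat. A \<inter> ordge (int N) \<subseteq> B'" using trunc BB' by blast
  qed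
  then interpret AB': finite_codim A B' .
  show "val_semigroup B' = insert h (val_semigroup B)"
  proof
    obtain w where w: "w \<in> A" "w \<in> ordge (int h)" "w $$ int h \<noteq> 0" using h by (auto simp: val_iff)
    have "w = 0 + w \<and> 0 \<in> B \<and> w \<in> A \<and> w \<in> ordge (int h)" using w kspaceD(1)[OF B] by simp
    then have "w \<in> B'" unfolding B'_def by blast
    then show "insert h (val_semigroup B) \<subseteq> val_semigroup B'"
      using val_mono[OF BB'] w by (auto simp: val_iff)
    show "val_semigroup B' \<subseteq> insert h (val_semigroup B)"
    proof
      fix u assume u: "u \<in> val_semigroup B'"
      then obtain b f where r: "b \<in> B" "f \<in> ordge (int h)" "b + f \<in> ordge (int u)" "(b + f) $$ int u \<noteq> 0"
        unfolding val_iff B'_def by blast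
      show "u \<in> insert h (val_semigroup B)"
      proof (cases "u < h")
        case True
        have "b = (b + f) - f" by simp
        moreover have "(b + f) - f \<in> ordge (int u)"
          by (intro ordge_diff r(3) ordge_mono[OF r(2)]) (use True in simp)
        moreover have "f $$ int u = 0" using ordgeD[OF r(2)] True by simp
        ultimately show ?thesis using r(1,4) val_iff[of u B] by auto
      next
        case False
        have "u \<in> val_semigroup A" using u val_mono[OF AB'.sub] by blast
        then show ?thesis using False max[of u] by auto
      qed
    qed
  qed
qed

context val_ring
begin

lemma submodule_iff':
  "submodule L (ring_on A) laurent_module \<longleftrightarrow>
    0 \<in> L \<and> (\<forall>f\<in>L. \<forall>g\<in>L. f + g \<in> L) \<and> (\<forall>r\<in>A. \<forall>f\<in>L. r * f \<in> L)"
  by (rule submodule_iff[OF zero_one(3)])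

lemma submodule_kspace: "submodule L (ring_on A) laurent_module \<Longrightarrow> kspace L"
  unfolding submodule_iff' kspace_def using const by blast

lemma chain_exists:
  assumes "finite_codim L M" "submodule L (ring_on A) laurent_module" "submodule M (ring_on A) laurent_module"
  shows "\<exists>C. (\<forall>i\<le>card (val_semigroup L - val_semigroup M).
      submodule (C i) (ring_on A) laurent_module \<and> M \<subseteq> C i \<and> C i \<subseteq> L)
    \<and> (\<forall>i<card (val_semigroup L - val_semigroup M). C i \<subset> C (Suc i))"
  using assms
proof (induction "card (val_semigroup L - val_semigroup M)" arbitrary: M)
  case 0
  then have "M \<subseteq> L" by (simp add: finite_codim_def)
  then show ?case using 0 by (intro exI[of _ "\<lambda>_. M"]) simp
next
  case (Suc d)
  interpret finite_codim L M by fact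
  define D where "D = val_semigroup L - val_semigroup M"
  have D: "finite D" "D \<noteq> {}" using Suc.hyps(2) finite_vals unfolding D_def by force+
  \<comment> \<open>Adding a single vector need not give a submodule. All of \<open>L\<close> from
    the largest missing order on is added instead; this is stable under \<open>A\<close>, whose
    elements have nonnegative order, and still creates just one new value.\<close>
  define M' where "M' = {b + f | b f. b \<in> M \<and> f \<in> L \<and> f \<in> ordge (int (Max D))}"
  have M': "finite_codim L M'" "M \<subseteq> M'" "val_semigroup M' = insert (Max D) (val_semigroup M)"
    unfolding M'_def using finite_codim_add_tail[OF Suc.prems(1), of "Max D"] Max_in[OF D] Max_ge[OF D(1)]
    unfolding D_def by blast+
  have sub': "submodule M' (ring_on A) laurent_module"
    unfolding submodule_iff'
  proof (intro conjI ballI)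
    show "0 \<in> M'" "\<And>f g. f \<in> M' \<Longrightarrow> g \<in> M' \<Longrightarrow> f + g \<in> M'"
      using M'(1) kspaceD(1,2) unfolding finite_codim_def by blast+
    fix r f assume r: "r \<in> A" and "f \<in> M'"
    then obtain b g where 1: "f = b + g" "b \<in> M" "g \<in> L" "g \<in> ordge (int (Max D))" unfolding M'_def by blast
    have "r * f = r * b + r * g" by (simp add: 1 distrib_left)
    moreover have "r * b \<in> M" "r * g \<in> L" using r 1 Suc.prems(2,3) unfolding submodule_iff' by blast+
    moreover have "r * g \<in> ordge (int (Max D))" using ordge_mult[of r 0 g] r nonneg 1(4) by auto
    ultimately show "r * f \<in> M'" unfolding M'_def by blast
  qed
  have "val_semigroup L - val_semigroup M' = D - {Max D}" unfolding M' D_def by blast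
  then have card: "d = card (val_semigroup L - val_semigroup M')"
    using Suc.hyps(2) Max_in[OF D] D(1) unfolding D_def[symmetric] by simp
  from Suc.hyps(1)[OF this M'(1) Suc.prems(2) sub']
  obtain C where C: "\<forall>i\<le>d. submodule (C i) (ring_on A) laurent_module \<and> M' \<subseteq> C i \<and> C i \<subseteq> L"
    "\<forall>i<d. C i \<subset> C (Suc i)" unfolding card[symmetric] by blast
  have "M \<noteq> M'" using M'(3) Max_in[OF D] unfolding D_def by blast
  then have "M \<subset> C 0" using C(1) M'(2) by blast
  then have "(\<forall>i\<le>Suc d. submodule (case_nat M C i) (ring_on A) laurent_module \<and> M \<subseteq> case_nat M C i \<and> case_nat M C i \<subseteq> L)
    \<and> (\<forall>i<Suc d. case_nat M C i \<subset> case_nat M C (Suc i))"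
  proof (intro conjI allI impI)
    fix i assume i: "i \<le> Suc d"
    show "submodule (case_nat M C i) (ring_on A) laurent_module"
      using C(1) i Suc.prems(3) by (cases i) auto
    have "M \<subseteq> C j \<and> C j \<subseteq> L" if "j \<le> d" for j using C(1) M'(2) that by blast
    then show "M \<subseteq> case_nat M C i" "case_nat M C i \<subseteq> L" using i sub by (cases i; simp)+
  next
    fix i assume "i < Suc d"
    then show "case_nat M C i \<subset> case_nat M C (Suc i)" using C(2) \<open>M \<subset> C 0\<close> by (cases i) auto
  qed
  then show ?case unfolding Suc.hyps(2)[symmetric] by blast
qed

text \<open>Each strict inclusion of submodules adds a value by \<open>eq_of_vals\<close>, which
  bounds every chain; \<open>chain_exists\<close> attains the bound.\<close>

lemma quot_length_eq:
  assumes LM: "finite_codim L M"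
    and L: "submodule L (ring_on A) laurent_module" and M: "submodule M (ring_on A) laurent_module"
  shows "quot_length A L M = enat (card (val_semigroup L - val_semigroup M))"
proof (rule antisym)
  interpret finite_codim L M by fact
  show "enat (card (val_semigroup L - val_semigroup M)) \<le> quot_length A L M"
    unfolding quot_length_def using chain_exists[OF assms] by (intro Sup_upper) blast
  show "quot_length A L M \<le> enat (card (val_semigroup L - val_semigroup M))"
    unfolding quot_length_def
  proof (rule Sup_least, clarsimp)
    fix n C
    assume C: "\<forall>i\<le>n. submodule (C i) (ring_on A) laurent_module \<and> M \<subseteq> C i \<and> C i \<subseteq> L"
      "\<forall>i<n. C i \<subset> C (Suc i)"
    have "i \<le> card (val_semigroup (C i) - val_semigroup M)" if "i \<le> n" for i
      using that
    proof (induction i)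
      case (Suc i)
      have ci: "C i \<subset> C (Suc i)" "M \<subseteq> C i" "C (Suc i) \<subseteq> L" using C Suc.prems by auto
      have "finite_codim (C (Suc i)) (C i)"
      proof
        show "kspace (C (Suc i))" "kspace (C i)" using submodule_kspace C(1) Suc.prems by simp_all
        show "C i \<subseteq> C (Suc i)" "C (Suc i) \<subseteq> ordge 0" using ci A0 by blast+
        show "\<exists>N::nat. C (Suc i) \<inter> ordge (int N) \<subseteq> C i" using trunc ci by blast
      qed
      then have "\<not> val_semigroup (C (Suc i)) \<subseteq> val_semigroup (C i)"
        using finite_codim.eq_of_vals ci(1) by blast
      then have "val_semigroup (C i) - val_semigroup M \<subset> val_semigroup (C (Suc i)) - val_semigroup M"
        using val_mono[of "C i" "C (Suc i)"] val_mono[of M "C i"] ci by blast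
      moreover have "finite (val_semigroup (C (Suc i)) - val_semigroup M)"
        using finite_vals val_mono[OF ci(3)] by (auto elim: rev_finite_subset)
      ultimately have "card (val_semigroup (C i) - val_semigroup M) < card (val_semigroup (C (Suc i)) - val_semigroup M)"
        by (rule psubset_card_mono[rotated])
      then show ?case using Suc by simp
    qed simp
    from this[of n] have "n \<le> card (val_semigroup (C n) - val_semigroup M)" by simp
    also have "\<dots> \<le> card (val_semigroup L - val_semigroup M)"
      using C(1) by (intro card_mono finite_vals Diff_mono val_mono) auto
    finally show "n \<le> card (val_semigroup L - val_semigroup M)" .
  qed
qed

end

text \<open>For a numerical semigroup this is the size of the Apery set of \<open>m\<close>. Cutting
  \<open>H\<close> at \<open>c + m\<close> and correspondingly the translate turns the count into a
  difference of finite cardinalities.\<close>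

lemma card_diff_translate:
  fixes H :: "nat set"
  assumes add: "\<And>h. h \<in> H \<Longrightarrow> m + h \<in> H" and c: "{c..} \<subseteq> H"
  shows "finite (H - (+) m ` H)" "card (H - (+) m ` H) = m"
proof -
  have mem: "v \<in> (+) m ` H \<longleftrightarrow> m \<le> v \<and> v - m \<in> H" for v
    by (auto simp: image_iff) (metis le_add_diff_inverse)
  have "H - (+) m ` H = (H \<inter> {..<c+m}) - (+) m ` (H \<inter> {..<c})"
  proof (rule Set.set_eqI)
    fix v
    have "v < c + m" if "v \<notin> (+) m ` H"
      using that c unfolding mem by (auto simp: subset_iff) (metis add.commute le_diff_conv2 not_less add_leE)
    moreover have "v \<in> (+) m ` (H \<inter> {..<c}) \<longleftrightarrow> v \<in> (+) m ` H \<and> v < c + m" by auto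
    ultimately show "v \<in> H - (+) m ` H \<longleftrightarrow> v \<in> (H \<inter> {..<c+m}) - (+) m ` (H \<inter> {..<c})" by blast
  qed
  moreover have "H \<inter> {..<c+m} = (H \<inter> {..<c}) \<union> {c..<c+m}" using c by auto
  moreover have "card ((H \<inter> {..<c}) \<union> {c..<c+m}) = card (H \<inter> {..<c}) + m"
    by (subst card_Un_disjoint) auto
  moreover have "card ((+) m ` (H \<inter> {..<c})) = card (H \<inter> {..<c})"
    by (rule card_image) simp
  moreover have "(+) m ` (H \<inter> {..<c}) \<subseteq> H \<inter> {..<c+m}" using add by auto
  ultimately show "finite (H - (+) m ` H)" "card (H - (+) m ` H) = m"
    by (simp_all add: card_Diff_subset)
qed

subsection \<open>Type, reduced type and multiplicity\<close>

definition semigroup_conductor :: "nat set \<Rightarrow> nat" where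
  "semigroup_conductor H = (LEAST c. {c..} \<subseteq> H)"

lemma semigroup_conductor: "{c..} \<subseteq> H \<Longrightarrow> {semigroup_conductor H..} \<subseteq> H"
  unfolding semigroup_conductor_def by (rule LeastI)

lemma semigroup_conductor_le: "{c..} \<subseteq> H \<Longrightarrow> semigroup_conductor H \<le> c"
  unfolding semigroup_conductor_def by (rule Least_le)

text \<open>The values that the socle of \<open>A/xA\<close> can have, for \<open>x\<close> of value \<open>e\<close>; up to a shift by \<open>e\<close>
  those outside \<open>e + H\<close> are the pseudo-Frobenius numbers.\<close>

definition socle_vals :: "nat set \<Rightarrow> nat \<Rightarrow> nat set" where
  "socle_vals H e = {h \<in> H. \<forall>h'\<in>H - {0}. h + h' \<in> (+) e ` H}"

lemma mem_translate: "v \<in> (+) e ` H \<longleftrightarrow> e \<le> v \<and> v - e \<in> (H :: nat set)"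
  by (auto simp: image_iff) (metis le_add_diff_inverse)

text \<open>Two disjoint families of gaps are counted: \<open>v - e\<close> for socle values
  \<open>v\<close> outside \<open>e + H\<close>, and the mirror images \<open>c - 1 - h\<close> of
  the elements \<open>h < c\<close> of \<open>H\<close>. The summand 1 pays for
  \<open>v = c - 1 + e\<close>, whose gap \<open>c - 1\<close> is also the mirror image of
  0.\<close>

lemma card_socle_vals_le:
  assumes add: "\<And>g h. g \<in> H \<Longrightarrow> h \<in> H \<Longrightarrow> g + h \<in> H"
    and e: "0 < e" "e \<in> H" "\<And>h. h \<in> H - {0} \<Longrightarrow> e \<le> h"
    and c: "{c..} \<subseteq> H" "c - 1 \<notin> H" "0 < c"
  shows "card (socle_vals H e - (+) e ` H) + card (H - {c..}) \<le> card (UNIV - H) + 1"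
proof -
  define K where "K = socle_vals H e - (+) e ` H"
  have gaps: "UNIV - H \<subseteq> {..<c}" using c(1) by (auto simp: subset_iff not_le[symmetric])
  have finK: "finite K"
  proof (rule finite_subset)
    show "K \<subseteq> {..<c+e}"
    proof
      fix v assume "v \<in> K"
      then have "\<not> (e \<le> v \<and> v - e \<in> H)" by (simp add: K_def mem_translate)
      moreover have "v - e \<in> H" "e \<le> v" if "c + e \<le> v" using c(1) that by auto
      ultimately show "v \<in> {..<c+e}" by (auto simp: not_le[symmetric])
    qed
  qed simp
  \<comment> \<open>If 0 were a socle value, every nonzero element would lie in
    \<open>e + H\<close>, so \<open>H\<close> would consist of multiples of \<open>e\<close>; then
    \<open>e = 1\<close> and \<open>c - 1\<close> would not be a gap. This secures
    \<open>e \<le> v\<close> for the subtractions below.\<close>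
  have zero: "0 \<notin> socle_vals H e"
  proof
    assume 0: "0 \<in> socle_vals H e"
    have dvd: "h \<in> H \<Longrightarrow> e dvd h" for h
    proof (induction h rule: less_induct)
      case (less h)
      show ?case
      proof (cases "h = 0")
        case False
        then have h: "e \<le> h" "h - e \<in> H"
          using 0 less.prems by (auto simp: socle_vals_def mem_translate)
        then have "e dvd h - e" using less.IH[of "h - e"] e(1) \<open>h \<noteq> 0\<close> by simp
        then show ?thesis using h(1) by (metis dvd_diffD dvd_refl)
      qed simp
    qed
    have "e dvd c" "e dvd Suc c" using c(1) by (auto intro!: dvd)
    then have "e = 1" by (metis dvd_add_right_iff nat_dvd_1_iff_1 Suc_eq_plus1)
    then have "1 \<in> H" using e(2) by simp
    have "n \<in> H" for n
    proof (induction n)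
      case (Suc n)
      then show ?case using add[OF \<open>1 \<in> H\<close>] by simp
    qed (use 0 in \<open>simp add: socle_vals_def\<close>)
    then show False using c(2) by blast
  qed
  have K: "e \<le> v" "v - e \<notin> H" if "v \<in> K" for v
  proof -
    have "v \<in> H" "v \<noteq> 0" using that zero unfolding K_def by (auto simp: socle_vals_def)
    then show "e \<le> v" using e by simp
    then show "v - e \<notin> H" using that by (simp add: K_def mem_translate)
  qed
  define I1 where "I1 = (\<lambda>v. v - e) ` (K - {c - 1 + e})"
  define I2 where "I2 = (\<lambda>h. c - 1 - h) ` (H - {c..})"
  have I1: "card I1 = card (K - {c - 1 + e})" unfolding I1_def
    by (rule card_image) (auto intro!: inj_onI dest: K, metis K(1) le_add_diff_inverse)
  have I2: "card I2 = card (H - {c..})" unfolding I2_def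
    by (rule card_image) (auto intro!: inj_onI)
  have "I1 \<subseteq> UNIV - H" unfolding I1_def using K by auto
  moreover have "I2 \<subseteq> UNIV - H"
  proof -
    have "c - 1 - h \<notin> H" if "h \<in> H" "h < c" for h
    proof
      assume "c - 1 - h \<in> H"
      then have "c - 1 - h + h \<in> H" using that(1) by (rule add)
      then show False using c(2) that(2) by simp
    qed
    then show ?thesis unfolding I2_def by auto
  qed
  moreover have "I1 \<inter> I2 = {}"
  proof -
    have False if v: "v \<in> K" "v \<noteq> c - 1 + e" and h: "h \<in> H" "h \<notin> {c..}" and eq: "v - e = c - 1 - h" for v h
    proof -
      \<comment> \<open>For \<open>h \<noteq> 0\<close> the socle condition puts
        \<open>e + (c - 1)\<close> into \<open>e + H\<close>, although \<open>c - 1\<close> is a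
        gap; \<open>h = 0\<close> leads to the excluded \<open>v\<close>.\<close>
      have vh: "v + h = e + (c - 1)" using K(1)[OF v(1)] h(2) eq by simp
      show False
      proof (cases "h = 0")
        case False
        then have "v + h \<in> (+) e ` H" using v(1) h(1) unfolding K_def socle_vals_def by simp
        then show False using c(2) by (simp add: mem_translate vh)
      qed (use vh v(2) in simp)
    qed
    then show ?thesis unfolding I1_def I2_def by (blast intro: leI)
  qed
  ultimately have "card I1 + card I2 \<le> card (UNIV - H)"
    using gaps by (subst card_Un_disjoint[symmetric]) (auto intro!: card_mono elim: finite_subset)
  moreover have "card K \<le> card (K - {c - 1 + e}) + 1"
    using finK by (cases "c - 1 + e \<in> K") (auto simp: card_Diff_singleton)
  ultimately show ?thesis using I1 I2 unfolding K_def by simp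
qed

lemma val_ordge: "val_semigroup (ordge (int n) :: 'k::field fls set) = {n..}"
proof
  show "val_semigroup (ordge (int n) :: 'k fls set) \<subseteq> {n..}"
    by (auto simp: val_iff) (metis ordgeD not_le of_nat_less_iff)
  show "{n..} \<subseteq> val_semigroup (ordge (int n) :: 'k fls set)"
  proof
    fix v assume "v \<in> {n..}"
    then have "(fls_X :: 'k fls) ^ v \<in> ordge (int n) \<and> fls_X ^ v \<in> (ordge (int v) :: 'k fls set) \<and> ((fls_X :: 'k fls) ^ v) $$ int v \<noteq> 0"
      by (auto simp: ordge_def)
    then show "v \<in> val_semigroup (ordge (int n) :: 'k fls set)" unfolding val_iff by blast
  qed
qed

lemma kspace_ordge: "kspace (ordge n)"
  unfolding kspace_def by (auto intro: ordge_add ordge_const_mult)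

section \<open>The value semigroup, the conductor and the maximal ideal\<close>

context val_ring
begin

lemma finite_codimI:
  assumes "kspace L" "kspace M" "M \<subseteq> L" "L \<subseteq> ordge 0" "ordge (int N) \<subseteq> M"
  shows "finite_codim L M"
  using assms by unfold_locales auto

lemma zero_val: "0 \<in> val_semigroup A"
  unfolding val_iff using zero_one(2) by (intro bexI[of _ 1]) (auto simp: ordge_def)

lemma add_val:
  assumes "g \<in> val_semigroup A" "h \<in> val_semigroup A"
  shows "g + h \<in> val_semigroup A"
proof -
  obtain r s where "r \<in> A" "r \<noteq> 0" "fls_subdegree r = int g" "s \<in> A" "s \<noteq> 0" "fls_subdegree s = int h"
    using assms unfolding val_semigroup_def by auto
  then have "r * s \<in> A \<and> r * s \<noteq> 0 \<and> fls_subdegree (r * s) = int (g + h)" by (simp add: mult)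
  then show ?thesis unfolding val_semigroup_def by blast
qed

lemma val_tail: "\<exists>c. {c..} \<subseteq> val_semigroup A"
proof -
  obtain N :: nat where N: "ordge (int N) \<subseteq> A" using tail by blast
  from val_mono[OF this] show ?thesis by (auto simp: val_ordge)
qed

definition c :: nat where "c = semigroup_conductor (val_semigroup A)"

lemma c_tail: "{c..} \<subseteq> val_semigroup A"
  unfolding c_def using val_tail semigroup_conductor by blast

text \<open>\<open>t^c k[[t]]\<close> and its intersection with \<open>A\<close> have the same
  values and agree in high orders, so they coincide. The unspecified bound of \<open>tail\<close> is
  thus replaced by one read off from the semigroup.\<close>

lemma ordge_c: "ordge (int c) \<subseteq> A"
proof -
  obtain N :: nat where N: "ordge (int N) \<subseteq> A" using tail by blast
  interpret finite_codim "ordge (int c)" "A \<inter> ordge (int c)"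
  proof
    show "kspace (ordge (int c) :: 'k fls set)" by (rule kspace_ordge)
    show "kspace (A \<inter> ordge (int c))"
      using kspace kspace_ordge[of "int c"] unfolding kspace_def by blast
    show "ordge (int c) \<subseteq> (ordge 0 :: 'k fls set)" by (auto intro: ordge_mono)
    show "\<exists>N::nat. ordge (int c) \<inter> ordge (int N) \<subseteq> A \<inter> ordge (int c)" using N by blast
    show "A \<inter> ordge (int c) \<subseteq> ordge (int c)" by blast
  qed
  have "val_semigroup (ordge (int c) :: 'k fls set) \<subseteq> val_semigroup (A \<inter> ordge (int c))"
  proof
    fix v assume "v \<in> val_semigroup (ordge (int c) :: 'k fls set)"
    then have v: "c \<le> v" "v \<in> val_semigroup A" using c_tail by (auto simp: val_ordge)
    then obtain r where r: "r \<in> A" "r \<in> ordge (int v)" "r $$ int v \<noteq> 0" by (auto simp: val_iff)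
    then have "r \<in> ordge (int c)" using v by (auto intro: ordge_mono)
    then show "v \<in> val_semigroup (A \<inter> ordge (int c))" using r unfolding val_iff by blast
  qed
  then show ?thesis using eq_of_vals by blast
qed

lemma conductor_eq: "conductor A = ordge (int c)"
proof
  show "ordge (int c) \<subseteq> conductor A"
    unfolding conductor_def frac_field_eq int_closure_eq using ordge_c ordge_mult[of _ "int c" _ 0] by auto
  show "conductor A \<subseteq> ordge (int c)"
  proof
    fix f assume "f \<in> conductor A"
    then have f: "\<And>g. g \<in> ordge 0 \<Longrightarrow> f * g \<in> A" unfolding conductor_def int_closure_eq by blast
    show "f \<in> ordge (int c)"
    proof (cases "f = 0")
      case False
      have "f * 1 \<in> A" by (intro f) (auto simp: ordge_def)
      then have d0: "fls_subdegree f \<ge> 0" using nonneg False by (auto simp: ordge_iff)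
      define d where "d = nat (fls_subdegree f)"
      have d: "fls_subdegree f = int d" using d0 by (simp add: d_def)
      \<comment> \<open>The products of \<open>f\<close> with powers of \<open>t\<close> realise
        every value from \<open>d\<close> on.\<close>
      have "{d..} \<subseteq> val_semigroup A"
      proof
        fix v assume "v \<in> {d..}"
        then have "f * fls_X ^ (v - d) \<in> A \<and> f * fls_X ^ (v - d) \<noteq> 0 \<and> fls_subdegree (f * fls_X ^ (v - d)) = int v"
          using False d by (intro conjI f) (auto simp: ordge_def simp del: fls_X_power_times_conv_shift)
        then show "v \<in> val_semigroup A" unfolding val_semigroup_def by blast
      qed
      then have "c \<le> d" unfolding c_def by (rule semigroup_conductor_le)
      then show ?thesis using d by (simp add: ordge_iff)
    qed simp
  qed
qed

lemma val_max_ideal: "val_semigroup (max_ideal A) = val_semigroup A - {0}"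
proof
  show "val_semigroup (max_ideal A) \<subseteq> val_semigroup A - {0}"
  proof
    fix v assume "v \<in> val_semigroup (max_ideal A)"
    then obtain r where r: "r \<in> A" "r \<in> ordge 1" "r \<in> ordge (int v)" "r $$ int v \<noteq> 0"
      unfolding max_ideal_eq val_iff by blast
    then have "v \<noteq> 0" using ordgeD[OF r(2), of 0] by (cases "v = 0") auto
    then show "v \<in> val_semigroup A - {0}" using r by (auto simp: val_iff)
  qed
  show "val_semigroup A - {0} \<subseteq> val_semigroup (max_ideal A)"
  proof
    fix v assume v: "v \<in> val_semigroup A - {0}"
    then obtain r where r: "r \<in> A" "r \<in> ordge (int v)" "r $$ int v \<noteq> 0" by (auto simp: val_iff)
    then have "r \<in> ordge 1" using v by (auto intro: ordge_mono)
    then show "v \<in> val_semigroup (max_ideal A)" using r unfolding max_ideal_eq val_iff by blast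
  qed
qed

end

text \<open>\<open>x\<close> stands for \<open>x 1\<close> in \<open>R\<close> and for
  \<open>t^e\<close> in \<open>k[[H]]\<close>; the number \<open>e\<close> is the same for
  both.\<close>

locale val_ring_param = val_ring A for A :: "'k::field fls set" +
  fixes x :: "'k fls" and e :: nat
  assumes x: "x \<in> A" "x \<noteq> 0" "fls_subdegree x = int e"
    and e_pos: "0 < e"
    and e_least: "\<And>h. h \<in> val_semigroup A - {0} \<Longrightarrow> e \<le> h"
begin

abbreviation "H \<equiv> val_semigroup A"

lemma e_val: "e \<in> H"
  unfolding val_semigroup_def using x by blast

lemma max_ideal_ordge: "max_ideal A \<subseteq> ordge (int e)"
proof
  fix f assume f: "f \<in> max_ideal A"
  show "f \<in> ordge (int e)"
  proof (cases "f = 0")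
    case False
    then have "fls_subdegree f \<ge> 1" using f by (auto simp: max_ideal_eq ordge_iff)
    then have "nat (fls_subdegree f) \<in> val_semigroup (max_ideal A)"
      unfolding val_semigroup_def using f False by (auto intro: bexI[of _ f])
    then show ?thesis using e_least \<open>fls_subdegree f \<ge> 1\<close>
      unfolding val_max_ideal by (fastforce simp: ordge_iff)
  qed simp
qed

lemma x_max_ideal: "x \<in> max_ideal A"
  unfolding max_ideal_eq using x e_pos by (auto simp: ordge_iff)

lemma principal_module:
  "0 \<in> principal A x" "f \<in> principal A x \<Longrightarrow> g \<in> principal A x \<Longrightarrow> f + g \<in> principal A x"
  "r \<in> A \<Longrightarrow> f \<in> principal A x \<Longrightarrow> r * f \<in> principal A x"
proof -
  show "0 \<in> principal A x" unfolding principal_def using zero_one(1) by force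
  show "f + g \<in> principal A x" if fg: "f \<in> principal A x" "g \<in> principal A x"
  proof -
    obtain a b where "f = x * a" "g = x * b" "a \<in> A" "b \<in> A" using fg unfolding principal_def by blast
    then have "f + g = x * (a + b) \<and> a + b \<in> A" by (simp add: distrib_left add)
    then show ?thesis unfolding principal_def by blast
  qed
  show "r * f \<in> principal A x" if rf: "r \<in> A" "f \<in> principal A x"
  proof -
    obtain a where "f = x * a" "a \<in> A" using rf unfolding principal_def by blast
    then have "r * f = x * (r * a) \<and> r * a \<in> A" using rf by (simp add: mult)
    then show ?thesis unfolding principal_def by blast
  qed
qed

lemma principal_subset: "principal A x \<subseteq> A"
  unfolding principal_def using x mult by blast

lemma kspace_principal: "kspace (principal A x)"
  unfolding kspace_def using principal_module const by blast

lemma ordge_principal: "ordge (int (c + e)) \<subseteq> principal A x"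
proof
  fix f :: "'k fls" assume "f \<in> ordge (int (c + e))"
  then have "f / x \<in> A" using ordge_div[of f _ x "int c"] x ordge_c by auto
  moreover have "f = x * (f / x)" using x by simp
  ultimately show "f \<in> principal A x" unfolding principal_def by blast
qed

lemma val_translate:
  assumes g: "g \<noteq> 0" "fls_subdegree g = int m" and L: "L \<subseteq> ordge 0"
  shows "val_semigroup {g * r | r. r \<in> L} = (+) m ` val_semigroup L"
proof
  show "val_semigroup {g * r | r. r \<in> L} \<subseteq> (+) m ` val_semigroup L"
  proof
    fix v assume "v \<in> val_semigroup {g * r | r. r \<in> L}"
    then obtain r where r: "r \<in> L" "g * r \<noteq> 0" "fls_subdegree (g * r) = int v"
      unfolding val_semigroup_def by blast
    then have sub: "r \<noteq> 0" "fls_subdegree r + int m = int v" "fls_subdegree r \<ge> 0"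
      using g L by (auto simp: ordge_iff)
    then have "fls_subdegree r = int (v - m)" "v = m + (v - m)" by linarith+
    then show "v \<in> (+) m ` val_semigroup L" using r(1) sub(1) unfolding val_semigroup_def by blast
  qed
  show "(+) m ` val_semigroup L \<subseteq> val_semigroup {g * r | r. r \<in> L}"
  proof
    fix v assume "v \<in> (+) m ` val_semigroup L"
    then obtain h r where r: "v = m + h" "r \<in> L" "r \<noteq> 0" "fls_subdegree r = int h"
      unfolding val_semigroup_def by blast
    then have "g * r \<noteq> 0 \<and> fls_subdegree (g * r) = int v" using assms by simp
    then show "v \<in> val_semigroup {g * r | r. r \<in> L}" using r(2) unfolding val_semigroup_def by blast
  qed
qed

lemma val_principal: "val_semigroup (principal A x) = (+) e ` H"
  unfolding principal_def by (rule val_translate) (use x nonneg in auto)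

lemma conductor_principal: "finite_codim {f + g | f g. f \<in> conductor A \<and> g \<in> principal A x} (principal A x)"
  "val_semigroup {f + g | f g. f \<in> conductor A \<and> g \<in> principal A x} = {c..} \<union> (+) e ` H"
proof -
  let ?C = "{f + g | f g. f \<in> conductor A \<and> g \<in> principal A x}"
  have P: "principal A x \<subseteq> ?C"
  proof
    fix g assume "g \<in> principal A x"
    then have "g = 0 + g \<and> 0 \<in> conductor A \<and> g \<in> principal A x" by (simp add: conductor_eq)
    then show "g \<in> ?C" by blast
  qed
  have C: "conductor A \<subseteq> ?C"
  proof
    fix f assume "f \<in> conductor A"
    then have "f = f + 0 \<and> f \<in> conductor A \<and> 0 \<in> principal A x" using principal_module(1) by simp
    then show "f \<in> ?C" by blast
  qed
  have CA: "?C \<subseteq> A" using ordge_c principal_subset add unfolding conductor_eq by blast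
  have k: "kspace ?C" unfolding kspace_def
  proof (intro conjI allI ballI)
    show "0 \<in> ?C" using P principal_module(1) by blast
    fix f g a assume "f \<in> ?C"
    then obtain f1 f2 where f: "f = f1 + f2" "f1 \<in> ordge (int c)" "f2 \<in> principal A x"
      unfolding conductor_eq by blast
    have "fls_const a * f = fls_const a * f1 + fls_const a * f2" by (simp add: f distrib_left)
    then show "fls_const a * f \<in> ?C" unfolding conductor_eq
      using ordge_const_mult[OF f(2)] kspaceD(3)[OF kspace_principal f(3)] by blast
    assume "g \<in> ?C"
    then obtain g1 g2 where g: "g = g1 + g2" "g1 \<in> ordge (int c)" "g2 \<in> principal A x"
      unfolding conductor_eq by blast
    have "f + g = (f1 + g1) + (f2 + g2)" by (simp add: f g)
    then show "f + g \<in> ?C" unfolding conductor_eq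
      using ordge_add[OF f(2) g(2)] principal_module(2)[OF f(3) g(3)] by blast
  qed
  show "finite_codim ?C (principal A x)"
    by (rule finite_codimI[OF k kspace_principal P]) (use CA nonneg ordge_principal in blast)+
  show "val_semigroup ?C = {c..} \<union> (+) e ` H"
  proof
    have "val_semigroup (conductor A) = {c..}" unfolding conductor_eq by (rule val_ordge)
    then show "{c..} \<union> (+) e ` H \<subseteq> val_semigroup ?C"
      using val_mono[OF C] val_mono[OF P] val_principal by blast
    show "val_semigroup ?C \<subseteq> {c..} \<union> (+) e ` H"
    proof
      fix v assume "v \<in> val_semigroup ?C"
      then obtain f g where fg: "f \<in> ordge (int c)" "g \<in> principal A x" "f + g \<in> ordge (int v)" "(f + g) $$ int v \<noteq> 0"
        unfolding val_iff conductor_eq by blast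
      show "v \<in> {c..} \<union> (+) e ` H"
      proof (cases "c \<le> v")
        case False
        \<comment> \<open>Below \<open>c\<close> the summand \<open>f\<close> is invisible, so
          \<open>v\<close> is already the value of \<open>g\<close>.\<close>
        have "(f + g) - f \<in> ordge (int v)"
          by (intro ordge_diff fg(3) ordge_mono[OF fg(1)]) (use False in simp)
        moreover have "f $$ int v = 0" using ordgeD[OF fg(1)] False by simp
        ultimately have "v \<in> val_semigroup (principal A x)" unfolding val_iff using fg by (intro bexI[of _ g]) auto
        then show ?thesis using val_principal by blast
      qed simp
    qed
  qed
qed

lemma reduced_type_eq: "reduced_type A x = enat (card ({c..} - (+) e ` H))"
proof -
  have "({c..} \<union> (+) e ` H) - (+) e ` H = {c..} - (+) e ` H" by blast
  then show ?thesis
    unfolding reduced_type_def finite_codim.quot_dim_eq[OF conductor_principal(1)]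
      conductor_principal(2) val_principal by simp
qed

text \<open>The colon \<open>xA : m\<close> in \<open>A\<close>; modulo \<open>xA\<close> it becomes
  the socle of \<open>A/xA\<close>.\<close>

definition socle :: "'k fls set" where
  "socle = {r \<in> A. \<forall>y\<in>max_ideal A. r * y \<in> principal A x}"

lemma finite_codim_socle: "finite_codim socle (principal A x)"
proof (rule finite_codimI[OF _ kspace_principal _ _ ordge_principal])
  show "kspace socle" unfolding kspace_def
  proof (intro conjI allI ballI)
    show "0 \<in> socle" using zero_one(1) principal_module(1) by (simp add: socle_def)
    fix f g a assume f: "f \<in> socle"
    have "fls_const a * (f * y) \<in> principal A x" if "y \<in> max_ideal A" for y
      using f that const principal_module(3) unfolding socle_def by blast
    then show "fls_const a * f \<in> socle" using f const mult by (simp add: socle_def mult.assoc)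
    assume g: "g \<in> socle"
    show "f + g \<in> socle" using f g add principal_module(2) by (simp add: socle_def distrib_right)
  qed
  show "principal A x \<subseteq> socle"
  proof
    fix f assume f: "f \<in> principal A x"
    then have "y * f \<in> principal A x" if "y \<in> max_ideal A" for y
      using principal_module(3) that unfolding max_ideal_eq by blast
    then show "f \<in> socle" using f principal_subset by (auto simp: socle_def mult.commute)
  qed
  show "socle \<subseteq> ordge 0" using nonneg by (auto simp: socle_def)
qed

lemma cm_type_eq: "cm_type A x = enat (card (val_semigroup socle - (+) e ` H))"
  unfolding cm_type_def socle_def[symmetric] finite_codim.quot_dim_eq[OF finite_codim_socle] val_principal ..

lemma val_socle: "val_semigroup socle \<subseteq> socle_vals H e"
proof
  fix v assume "v \<in> val_semigroup socle"
  then obtain r where r: "r \<in> socle" "r \<noteq> 0" "fls_subdegree r = int v"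
    unfolding val_semigroup_def by blast
  have "v + h \<in> (+) e ` H" if h: "h \<in> H - {0}" for h
  proof -
    have "h \<in> val_semigroup (max_ideal A)" using h val_max_ideal by blast
    then obtain y where y: "y \<in> max_ideal A" "y \<noteq> 0" "fls_subdegree y = int h"
      unfolding val_semigroup_def by blast
    have "r * y \<in> principal A x" using r(1) y(1) unfolding socle_def by blast
    moreover have "r * y \<noteq> 0 \<and> fls_subdegree (r * y) = int (v + h)" using r y by simp
    ultimately have "v + h \<in> val_semigroup (principal A x)" unfolding val_semigroup_def by blast
    then show ?thesis using val_principal by blast
  qed
  moreover have "v \<in> H" using r unfolding socle_def val_semigroup_def by blast
  ultimately show "v \<in> socle_vals H e" unfolding socle_vals_def by blast
qed

text \<open>An element of order at least \<open>c\<close> times one of the maximal ideal has order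
  at least \<open>c + e\<close>, and all series of that order lie in \<open>xA\<close>. This gives
  the bound of the reduced type by the type.\<close>

lemma conductor_val_socle: "{c..} \<subseteq> val_semigroup socle"
proof -
  have "f \<in> socle" if f: "f \<in> ordge (int c)" for f
  proof -
    have "f * y \<in> principal A x" if "y \<in> max_ideal A" for y
      using ordge_mult[OF f, of y "int e"] that max_ideal_ordge ordge_principal by auto
    then show ?thesis using f ordge_c unfolding socle_def by blast
  qed
  then have "val_semigroup (ordge (int c) :: 'k fls set) \<subseteq> val_semigroup socle" by (intro val_mono) blast
  then show ?thesis by (simp add: val_ordge)
qed

lemma finite_socle_vals: "finite (socle_vals H e - (+) e ` H)" "finite (H - (+) e ` H)" "card (H - (+) e ` H) = e"
proof -
  have *: "e + h \<in> H" if "h \<in> H" for h using add_val e_val that by blast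
  show "finite (H - (+) e ` H)" "card (H - (+) e ` H) = e"
    using card_diff_translate[of H e c, OF * c_tail] by auto
  from this(1) show "finite (socle_vals H e - (+) e ` H)"
    by (auto simp: socle_vals_def elim: rev_finite_subset)
qed

lemma reduced_type_le_cm_type: "reduced_type A x \<le> cm_type A x"
  unfolding reduced_type_eq cm_type_eq enat_ord_simps
  using conductor_val_socle val_socle finite_socle_vals(1)
  by (intro card_mono) (auto intro: rev_finite_subset)

lemma cm_type_le: "cm_type A x \<le> enat (card (socle_vals H e - (+) e ` H))"
  unfolding cm_type_eq enat_ord_simps
  using val_socle finite_socle_vals(1) by (intro card_mono) auto

end

section \<open>Powers of the maximal ideal, multiplicity and embedding dimension\<close>

context val_ring
begin

lemma ideal_prod_mult:
  assumes "f \<in> I" "g \<in> J"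
  shows "f * g \<in> ideal_prod (ring_on A) I J"
  using ideal_prod.prod[of f I g J "ring_on A"] assms by (simp add: ring_on_def)

text \<open>\<open>ideal_prod\<close> is generated by products and sums only, so 0 must itself arise
  as a product; \<open>g0\<close> serves for this.\<close>

lemma ideal_prod_module:
  assumes I: "0 \<in> I" "\<And>r f. r \<in> A \<Longrightarrow> f \<in> I \<Longrightarrow> r * f \<in> I" and J: "g0 \<in> J"
  shows "0 \<in> ideal_prod (ring_on A) I J"
    "f \<in> ideal_prod (ring_on A) I J \<Longrightarrow> g \<in> ideal_prod (ring_on A) I J \<Longrightarrow> f + g \<in> ideal_prod (ring_on A) I J"
    "r \<in> A \<Longrightarrow> f \<in> ideal_prod (ring_on A) I J \<Longrightarrow> r * f \<in> ideal_prod (ring_on A) I J"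
proof -
  have add: "f + g \<in> ideal_prod (ring_on A) I J"
    if "f \<in> ideal_prod (ring_on A) I J" "g \<in> ideal_prod (ring_on A) I J" for f g
    using ideal_prod.sum[OF that] by (simp add: ring_on_def)
  show "0 \<in> ideal_prod (ring_on A) I J" using ideal_prod_mult[OF I(1) J] by simp
  show "f \<in> ideal_prod (ring_on A) I J \<Longrightarrow> g \<in> ideal_prod (ring_on A) I J \<Longrightarrow> f + g \<in> ideal_prod (ring_on A) I J"
    by (rule add)
  show "r * f \<in> ideal_prod (ring_on A) I J" if r: "r \<in> A" and "f \<in> ideal_prod (ring_on A) I J"
    using that(2)
  proof induction
    case (prod i j)
    have "(r * i) * j \<in> ideal_prod (ring_on A) I J" using prod I(2)[OF r] by (intro ideal_prod_mult)
    then show ?case by (simp add: ring_on_def mult.assoc)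
  next
    case (sum s1 s2)
    then show ?case using add by (simp add: ring_on_def distrib_left)
  qed
qed

end

context val_ring_param
begin

lemma max_ideal_pow_module:
  "0 \<in> max_ideal_pow A n"
  "f \<in> max_ideal_pow A n \<Longrightarrow> g \<in> max_ideal_pow A n \<Longrightarrow> f + g \<in> max_ideal_pow A n"
  "r \<in> A \<Longrightarrow> f \<in> max_ideal_pow A n \<Longrightarrow> r * f \<in> max_ideal_pow A n"
proof -
  have "0 \<in> max_ideal_pow A n \<and>
    (\<forall>f\<in>max_ideal_pow A n. \<forall>g\<in>max_ideal_pow A n. f + g \<in> max_ideal_pow A n) \<and>
    (\<forall>r\<in>A. \<forall>f\<in>max_ideal_pow A n. r * f \<in> max_ideal_pow A n)"
  proof (induction n)
    case (Suc n)
    have "0 \<in> max_ideal_pow A n" "\<And>r f. r \<in> A \<Longrightarrow> f \<in> max_ideal_pow A n \<Longrightarrow> r * f \<in> max_ideal_pow A n"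
      using Suc by blast+
    from ideal_prod_module[OF this x_max_ideal] show ?case by simp
  qed (auto simp: zero_one add mult)
  then show "0 \<in> max_ideal_pow A n"
    "f \<in> max_ideal_pow A n \<Longrightarrow> g \<in> max_ideal_pow A n \<Longrightarrow> f + g \<in> max_ideal_pow A n"
    "r \<in> A \<Longrightarrow> f \<in> max_ideal_pow A n \<Longrightarrow> r * f \<in> max_ideal_pow A n" by blast+
qed

lemma max_ideal_pow_subset: "max_ideal_pow A n \<subseteq> A \<inter> ordge (int (n * e))"
proof (induction n)
  case 0
  then show ?case using nonneg by auto
next
  case (Suc n)
  have "f \<in> A \<inter> ordge (int (Suc n * e))"
    if "f \<in> ideal_prod (ring_on A) (max_ideal_pow A n) (max_ideal A)" for f
    using that
  proof induction
    case (prod i j)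
    then have i: "i \<in> A" "i \<in> ordge (int (n * e))" and j: "j \<in> A" "j \<in> ordge (int e)"
      using Suc max_ideal_ordge max_ideal_eq by blast+
    have "i * j \<in> ordge (int (Suc n * e))" by (rule ordge_mult'[OF i(2) j(2)]) simp
    then show ?case using mult i j by (simp add: ring_on_def)
  next
    case (sum s1 s2)
    then show ?case using add ordge_add by (auto simp: ring_on_def)
  qed
  then show ?case by auto
qed

lemma power_max_ideal_pow: "r \<in> A \<Longrightarrow> x ^ n * r \<in> max_ideal_pow A n"
proof (induction n)
  case (Suc n)
  from ideal_prod_mult[OF Suc.IH[OF Suc.prems] x_max_ideal] show ?case by (simp add: mult_ac)
qed simp

lemma ordge_max_ideal_pow: "ordge (int (c + n * e)) \<subseteq> max_ideal_pow A n"
proof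
  fix f :: "'k fls" assume f: "f \<in> ordge (int (c + n * e))"
  have "fls_subdegree (x ^ n) = int (n * e)" using x(3) by (simp add: fls_subdegree_pow)
  then have "f / x ^ n \<in> A" using ordge_div[OF f, of "x ^ n" "int c"] x(2) ordge_c by auto
  from power_max_ideal_pow[OF this, of n] show "f \<in> max_ideal_pow A n" using x(2) by simp
qed

lemma kspace_max_ideal_pow: "kspace (max_ideal_pow A n)"
  unfolding kspace_def using max_ideal_pow_module const by blast

lemma finite_codim_max_ideal_pow: "finite_codim A (max_ideal_pow A n)"
  by (rule finite_codimI[OF kspace kspace_max_ideal_pow _ nonneg ordge_max_ideal_pow])
    (use max_ideal_pow_subset in blast)

text \<open>The powers are squeezed by
  \<open>x^n A \<subseteq> m^n \<subseteq> t^(n e) k[[t]]\<close>. The left inclusion bounds the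
  length by \<open>n e\<close>; the right one leaves the values from \<open>c\<close> up to
  \<open>n e - 1\<close> uncovered.\<close>

lemma length_max_ideal_pow:
  "\<exists>l. quot_length A A (max_ideal_pow A n) = enat l \<and> n * e - c \<le> l \<and> l \<le> n * e"
proof (intro exI conjI)
  interpret finite_codim A "max_ideal_pow A n" by (rule finite_codim_max_ideal_pow)
  let ?P = "max_ideal_pow A n"
  show "quot_length A A ?P = enat (card (H - val_semigroup ?P))"
    by (rule quot_length_eq[OF finite_codim_max_ideal_pow])
      (use max_ideal_pow_module zero_one add mult in \<open>auto simp: submodule_iff'\<close>)
  have xn: "x ^ n \<in> A" "x ^ n \<noteq> 0" "fls_subdegree (x ^ n) = int (n * e)"
    using x by (simp_all add: power fls_subdegree_pow)
  then have "n * e \<in> H" unfolding val_semigroup_def by blast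
  then have closed: "n * e + h \<in> H" if "h \<in> H" for h using add_val that by blast
  have "(+) (n * e) ` H = val_semigroup {x ^ n * r | r. r \<in> A}"
    using val_translate[OF xn(2,3) nonneg] by simp
  also have "\<dots> \<subseteq> val_semigroup ?P"
    by (rule val_mono) (use power_max_ideal_pow in blast)
  finally have "H - val_semigroup ?P \<subseteq> H - (+) (n * e) ` H" by blast
  then show "card (H - val_semigroup ?P) \<le> n * e"
    using card_diff_translate[of H "n * e" c, OF closed c_tail] by (metis card_mono)
  have "v \<notin> val_semigroup ?P" if "v < n * e" for v
  proof -
    have "?P \<subseteq> ordge (int (n * e))" using max_ideal_pow_subset by blast
    from val_mono[OF this] have "val_semigroup ?P \<subseteq> {n * e..}" unfolding val_ordge .
    then show ?thesis using that by auto
  qed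
  then have "{c..<n * e} \<subseteq> H - val_semigroup ?P" using c_tail by auto
  from card_mono[OF finite_vals this] show "n * e - c \<le> card (H - val_semigroup ?P)" by simp
qed

lemma hs_multiplicity_eq: "hs_multiplicity A = ereal (real e)"
proof -
  obtain l where l: "\<And>n. quot_length A A (max_ideal_pow A n) = enat (l n) \<and> n * e - c \<le> l n \<and> l n \<le> n * e"
    using length_max_ideal_pow by metis
  have "(\<lambda>n. real (l n) / real n) \<longlonglongrightarrow> real e"
  proof (rule tendsto_sandwich)
    have "real e - real c / real n \<le> real (l n) / real n \<and> real (l n) / real n \<le> real e" if "n > 0" for n
    proof -
      have "n * e \<le> l n + c" "l n \<le> n * e" using l[of n] by auto
      then have "real n * real e \<le> real (l n) + real c" "real (l n) \<le> real n * real e"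
        by (simp_all flip: of_nat_mult of_nat_add)
      then have "(real n * real e - real c) / real n \<le> real (l n) / real n"
        "real (l n) / real n \<le> real n * real e / real n"
        by (intro divide_right_mono; simp)+
      then show ?thesis using that by (simp add: diff_divide_distrib)
    qed
    then have "\<forall>\<^sub>F n in sequentially. real e - real c / real n \<le> real (l n) / real n \<and> real (l n) / real n \<le> real e"
      by (intro eventually_mono[OF eventually_gt_at_top[of 0]])
    then show "\<forall>\<^sub>F n in sequentially. real e - real c / real n \<le> real (l n) / real n"
      "\<forall>\<^sub>F n in sequentially. real (l n) / real n \<le> real e"
      by (auto elim: eventually_mono)
    have "(\<lambda>n. real e - real c / real n) \<longlonglongrightarrow> real e - 0"
      by (intro tendsto_intros lim_const_over_n)
    then show "(\<lambda>n. real e - real c / real n) \<longlonglongrightarrow> real e" by simp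
  qed simp
  then have "(\<lambda>n. ereal (real (l n) / real n)) \<longlonglongrightarrow> ereal (real e)" by simp
  moreover have "\<forall>\<^sub>F n in sequentially. ereal (real (l n) / real n) =
      ereal_of_enat (quot_length A A (max_ideal_pow A n)) / ereal (real n)"
    by (rule eventually_mono[OF eventually_gt_at_top[of 0]]) (simp add: l)
  ultimately have "(\<lambda>n. ereal_of_enat (quot_length A A (max_ideal_pow A n)) / ereal (real n)) \<longlonglongrightarrow> ereal (real e)"
    by (rule Lim_transform_eventually)
  then show ?thesis unfolding hs_multiplicity_def by (rule limI)
qed

lemma max_ideal_pow_2:
  "f \<in> max_ideal A \<Longrightarrow> g \<in> max_ideal A \<Longrightarrow> f * g \<in> max_ideal_pow A 2"
  "max_ideal_pow A 2 \<subseteq> max_ideal A"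
proof -
  assume fg: "f \<in> max_ideal A" "g \<in> max_ideal A"
  have "1 * f \<in> ideal_prod (ring_on A) A (max_ideal A)" by (rule ideal_prod_mult[OF zero_one(2) fg(1)])
  then have "f \<in> max_ideal_pow A 1" by simp
  from ideal_prod_mult[OF this fg(2)] show "f * g \<in> max_ideal_pow A 2" by (simp add: numeral_2_eq_2)
next
  have "ordge (int (2 * e)) \<subseteq> (ordge 1 :: 'k fls set)" using e_pos by (auto intro: ordge_mono)
  then show "max_ideal_pow A 2 \<subseteq> max_ideal A"
    using max_ideal_pow_subset[of 2] unfolding max_ideal_eq by blast
qed

lemma kspace_max_ideal: "kspace (max_ideal A)"
  unfolding max_ideal_eq using kspace kspace_ordge[of 1] unfolding kspace_def by blast

lemma finite_codim_cotangent: "finite_codim (max_ideal A) (max_ideal_pow A 2)"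
  by (rule finite_codimI[OF kspace_max_ideal kspace_max_ideal_pow max_ideal_pow_2(2) _ ordge_max_ideal_pow])
    (use nonneg max_ideal_eq in blast)

lemma edim_eq: "edim A = enat (card (H - {0} - val_semigroup (max_ideal_pow A 2)))"
  unfolding edim_def finite_codim.quot_dim_eq[OF finite_codim_cotangent] val_max_ideal ..

lemma mult_max_ideal_subset: "{x * r | r. r \<in> max_ideal A} \<subseteq> max_ideal_pow A 2"
  using max_ideal_pow_2(1)[OF x_max_ideal] by blast

lemma val_mult_max_ideal: "val_semigroup {x * r | r. r \<in> max_ideal A} = (+) e ` (H - {0})"
proof -
  have "max_ideal A \<subseteq> ordge 0" using nonneg max_ideal_eq by blast
  from val_translate[OF x(2,3) this] show ?thesis by (simp add: val_max_ideal)
qed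

text \<open>Compared with \<open>H - (e + H)\<close> the element 0 is lost and \<open>e\<close> is
  gained, so the count stays \<open>e\<close>. It is the dimension of \<open>m/xm\<close>.\<close>

lemma card_cotangent_bound:
  "finite (H - {0} - (+) e ` (H - {0}))" "card (H - {0} - (+) e ` (H - {0})) = e"
proof -
  have "H - {0} - (+) e ` (H - {0}) = insert e ((H - (+) e ` H) - {0})"
    using e_val e_pos by auto
  moreover have "0 \<in> H - (+) e ` H" using zero_val e_pos by auto
  moreover have "e \<notin> (H - (+) e ` H) - {0}" using zero_val by auto
  ultimately show "finite (H - {0} - (+) e ` (H - {0}))" "card (H - {0} - (+) e ` (H - {0})) = e"
    using finite_socle_vals(2,3) e_pos by (simp_all add: card_Diff_singleton)
qed

text \<open>Since \<open>xm \<subseteq> m^2\<close>, the cotangent space \<open>m/m^2\<close> is a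
  quotient of \<open>m/xm\<close>.\<close>

lemma edim_le: "edim A \<le> enat e"
proof -
  have "H - {0} - val_semigroup (max_ideal_pow A 2) \<subseteq> H - {0} - (+) e ` (H - {0})"
    using val_mono[OF mult_max_ideal_subset] val_mult_max_ideal by blast
  from card_mono[OF card_cotangent_bound(1) this] show ?thesis
    unfolding edim_eq card_cotangent_bound(2) by simp
qed

text \<open>Minimal multiplicity means \<open>\<mm>\<^sup>2 = x\<mm>\<close>.\<close>

lemma minimal_multiplicity_socle:
  assumes "minimal_multiplicity A"
  shows "val_semigroup socle = socle_vals H e"
proof
  show "val_semigroup socle \<subseteq> socle_vals H e" by (rule val_socle)
  let ?E = "{x * r | r. r \<in> max_ideal A}" and ?Q = "max_ideal_pow A 2"
  have "ereal_of_enat (edim A) = ereal (real e)"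
    using assms unfolding minimal_multiplicity_def hs_multiplicity_eq .
  then have card: "card (H - {0} - val_semigroup ?Q) = e" unfolding edim_eq by simp
  \<comment> \<open>One inclusion together with equal finite cardinalities gives equality, so
    \<open>m^2\<close> and \<open>xm\<close> have the same values.\<close>
  have "H - {0} - val_semigroup ?Q = H - {0} - (+) e ` (H - {0})"
    using val_mono[OF mult_max_ideal_subset] val_mult_max_ideal card card_cotangent_bound
    by (intro card_subset_eq) auto
  moreover have "val_semigroup ?Q \<subseteq> H - {0}" using val_mono[OF max_ideal_pow_2(2)] val_max_ideal by blast
  ultimately have vals: "val_semigroup ?Q \<subseteq> val_semigroup ?E" unfolding val_mult_max_ideal by blast
  have "finite_codim ?Q ?E"
  proof (rule finite_codimI)
    show "kspace ?Q" by (rule kspace_max_ideal_pow)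
    show "kspace ?E" unfolding kspace_def
    proof (intro conjI allI ballI)
      show "0 \<in> ?E" using kspaceD(1)[OF kspace_max_ideal] by force
      fix f g a assume "f \<in> ?E"
      then obtain r where f: "f = x * r" "r \<in> max_ideal A" by blast
      have "fls_const a * f = x * (fls_const a * r)" by (simp add: f)
      then show "fls_const a * f \<in> ?E" using kspaceD(3)[OF kspace_max_ideal f(2)] by blast
      assume "g \<in> ?E"
      then obtain s where g: "g = x * s" "s \<in> max_ideal A" by blast
      have "f + g = x * (r + s)" by (simp add: f g distrib_left)
      then show "f + g \<in> ?E" using kspaceD(2)[OF kspace_max_ideal f(2) g(2)] by blast
    qed
    show "?E \<subseteq> ?Q" by (rule mult_max_ideal_subset)
    show "?Q \<subseteq> ordge 0" using max_ideal_pow_subset nonneg by blast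
    show "ordge (int (c + e + e)) \<subseteq> ?E"
    proof
      fix f :: "'k fls" assume f: "f \<in> ordge (int (c + e + e))"
      have "f / x \<in> ordge (int (c + e))" by (rule ordge_div[OF f x(2)]) (simp add: x)
      then have "f / x \<in> ordge (int c)" "f / x \<in> ordge 1"
        using e_pos by (auto elim!: ordge_mono)
      then have "f / x \<in> A" "f / x \<in> ordge 1" using ordge_c by blast+
      then have "f = x * (f / x) \<and> f / x \<in> max_ideal A" using x by (simp add: max_ideal_eq)
      then show "f \<in> ?E" by blast
    qed
  qed
  then have QE: "?Q = ?E" using vals by (rule finite_codim.eq_of_vals)
  \<comment> \<open>Products of two elements of \<open>m\<close> lie in \<open>xm\<close>, hence in
    \<open>xA\<close>. Thus every nonzero value of \<open>H\<close> occurs in the socle, and only 0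
    remains to be treated.\<close>
  have M: "max_ideal A \<subseteq> socle"
  proof
    fix r assume r: "r \<in> max_ideal A"
    have "r * y \<in> principal A x" if "y \<in> max_ideal A" for y
      using max_ideal_pow_2(1)[OF r that] unfolding QE principal_def max_ideal_eq by blast
    then show "r \<in> socle" using r max_ideal_eq unfolding socle_def by blast
  qed
  show "socle_vals H e \<subseteq> val_semigroup socle"
  proof
    fix v assume v: "v \<in> socle_vals H e"
    show "v \<in> val_semigroup socle"
    proof (cases "v = 0")
      case False
      then have "v \<in> val_semigroup (max_ideal A)" using v val_max_ideal unfolding socle_vals_def by blast
      then show ?thesis using val_mono[OF M] by blast
    next
      case True
      \<comment> \<open>If 0 is a socle value, every nonzero value lies in \<open>e + H\<close>;
        then \<open>m = xA\<close>, and 1 belongs to the socle.\<close>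
      then have "H - {0} \<subseteq> (+) e ` H" using v unfolding socle_vals_def by auto
      then have vals: "val_semigroup (max_ideal A) \<subseteq> val_semigroup (principal A x)"
        unfolding val_max_ideal val_principal .
      have "finite_codim (max_ideal A) (principal A x)"
      proof (rule finite_codimI[OF kspace_max_ideal kspace_principal _ _ ordge_principal])
        show "principal A x \<subseteq> max_ideal A"
        proof
          fix f assume "f \<in> principal A x"
          then obtain r where "f = x * r" "r \<in> A" unfolding principal_def by blast
          moreover have "x \<in> ordge 1" using x_max_ideal max_ideal_eq by blast
          ultimately show "f \<in> max_ideal A"
            using mult x(1) nonneg ordge_mult[of x 1 r 0] by (auto simp: max_ideal_eq)
        qed
        show "max_ideal A \<subseteq> ordge 0" using nonneg max_ideal_eq by blast
      qed
      then have "max_ideal A = principal A x" using vals by (rule finite_codim.eq_of_vals)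
      then have "1 \<in> socle" using zero_one(2) unfolding socle_def by auto
      then have "0 \<in> val_semigroup socle" unfolding val_semigroup_def by (intro CollectI bexI[of _ 1]) auto
      then show ?thesis using True by simp
    qed
  qed
qed

text \<open>The defining equation expresses the type by the numbers of gaps and of elements below
  \<open>c\<close>; \<open>card_socle_vals_le\<close> turns this into a lower bound that meets the
  upper bound \<open>cm_type_le\<close>.\<close>

lemma almost_Gorenstein_socle:
  assumes "almost_Gorenstein A x" "e \<noteq> 1"
  shows "cm_type A x = enat (card (socle_vals H e - (+) e ` H))"
proof -
  define t where "t = card (val_semigroup socle - (+) e ` H)"
  have k: "submodule A (ring_on A) laurent_module" "submodule (ordge 0) (ring_on A) laurent_module"
    "submodule (ordge (int c)) (ring_on A) laurent_module"
  proof -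
    have "r * f \<in> ordge n" if "r \<in> A" "f \<in> ordge n" for r f n
      using that nonneg ordge_mult[of r 0 f n] by auto
    then show "submodule A (ring_on A) laurent_module" "submodule (ordge 0) (ring_on A) laurent_module"
      "submodule (ordge (int c)) (ring_on A) laurent_module"
      unfolding submodule_iff' using zero_one(1) add mult ordge_add by auto
  qed
  have "finite_codim (ordge 0) A" using nonneg ordge_c by (intro finite_codimI kspace_ordge kspace) auto
  from quot_length_eq[OF this k(2,1)]
  have 1: "quot_length A (int_closure A) A = enat (card (UNIV - H))"
    using val_ordge[of 0, where 'k = 'k] unfolding int_closure_eq by simp
  have "finite_codim A (ordge (int c))" using nonneg ordge_c by (intro finite_codimI kspace_ordge kspace) auto
  from quot_length_eq[OF this k(1,3)]
  have 2: "quot_length A A (conductor A) = enat (card (H - {c..}))"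
    unfolding conductor_eq val_ordge .
  have eq: "card (UNIV - H) = card (H - {c..}) + t - 1"
    using assms(1) unfolding almost_Gorenstein_def 1 2 cm_type_eq t_def[symmetric]
    by (simp add: one_enat_def)
  have c0: "c \<noteq> 0"
  proof
    assume "c = 0"
    then have "1 \<in> H" using c_tail by auto
    then have "e \<le> 1" using e_least by auto
    then show False using e_pos assms(2) by simp
  qed
  have c1: "c - 1 \<notin> H"
  proof
    assume "c - 1 \<in> H"
    moreover have "v = c - 1 \<or> c \<le> v" if "c - 1 \<le> v" for v using that by linarith
    ultimately have "{c - 1..} \<subseteq> H" using c_tail by auto
    then have "c \<le> c - 1" unfolding c_def by (rule semigroup_conductor_le)
    then show False using c0 by simp
  qed
  have "card (socle_vals H e - (+) e ` H) + card (H - {c..}) \<le> card (UNIV - H) + 1"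
    using c0 c1 by (intro card_socle_vals_le add_val e_pos e_val e_least c_tail) auto
  \<comment> \<open>0 is an element of \<open>H\<close> below \<open>c\<close>, so the subtraction
    of 1 in \<open>eq\<close> is not truncated.\<close>
  moreover have "finite (H - {c..})" by (rule finite_subset[of _ "{..<c}"]) auto
  then have "card (H - {c..}) > 0" using c0 zero_val by (auto simp: card_gt_0_iff)
  ultimately have "card (socle_vals H e - (+) e ` H) \<le> t" using eq by simp
  moreover have "t \<le> card (socle_vals H e - (+) e ` H)"
    using cm_type_le unfolding cm_type_eq t_def by simp
  ultimately show ?thesis unfolding cm_type_eq t_def by simp
qed

end

subsection \<open>Minimal generators and semigroup rings\<close>

lemma has_sum_fls_iff:
  fixes f :: "'a \<Rightarrow> 'b::field fls"
  shows
  "(f has_sum F) A \<longleftrightarrow> (\<forall>N::nat. \<exists>X0. finite X0 \<and> X0 \<subseteq> A \<and>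
     (\<forall>X. finite X \<and> X0 \<subseteq> X \<and> X \<subseteq> A \<longrightarrow> sum f X - F \<in> ordge (int N)))"
proof -
  \<comment> \<open>Order at least \<open>N\<close> gives distance at most \<open>(1/2)^N\<close>,
    and distance below \<open>(1/2)^N\<close> gives order at least \<open>N\<close>. As these radii
    tend to 0, the two implications translate convergence into order conditions.\<close>
  have 1: "dist g h < r" if "g - h \<in> ordge (int N)" "(1 / 2) ^ N < r" for g h :: "'b::field fls" and r N
  proof (cases "g = h")
    case True
    have "(0::real) < (1 / 2) ^ N" by simp
    from order.strict_trans[OF this that(2)] show ?thesis using True by simp
  next
    case False
    then have s: "int N \<le> fls_subdegree (g - h)" using that(1) by (simp add: ordge_iff)
    then have "N \<le> nat (fls_subdegree (g - h))" by linarith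
    then have "inverse (2 ^ nat (fls_subdegree (g - h))) \<le> (1 / 2 :: real) ^ N"
      by (simp add: power_one_over field_simps)
    then show ?thesis using False s that(2) by (simp add: dist_fls_def)
  qed
  have 2: "g - h \<in> ordge (int N)" if "dist g h < (1 / 2) ^ N" for g h :: "'b::field fls" and N
  proof (rule ccontr)
    assume "g - h \<notin> ordge (int N)"
    then have gh: "g \<noteq> h" "fls_subdegree (g - h) < int N" by (auto simp: ordge_iff)
    have "(1 / 2 :: real) ^ N \<le> dist g h"
    proof (cases "fls_subdegree (g - h) \<ge> 0")
      case True
      then have "nat (fls_subdegree (g - h)) \<le> N" using gh by linarith
      then have "(2::real) ^ nat (fls_subdegree (g - h)) \<le> 2 ^ N" by (rule power_increasing) simp
      then show ?thesis using gh(1) True by (simp add: dist_fls_def power_one_over field_simps)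
    next
      case False
      have "(1 / 2 :: real) ^ N \<le> 1" by (rule power_le_one) auto
      also have "1 \<le> (2::real) ^ nat (- fls_subdegree (g - h))" by simp
      finally show ?thesis using gh(1) False by (simp add: dist_fls_def)
    qed
    then show False using that by simp
  qed
  show ?thesis
    unfolding has_sum_def tendsto_iff eventually_finite_subsets_at_top
  proof (intro iffI allI impI)
    fix N :: nat
    assume *: "\<forall>r>0. \<exists>X. finite X \<and> X \<subseteq> A \<and> (\<forall>Y. finite Y \<and> X \<subseteq> Y \<and> Y \<subseteq> A \<longrightarrow> dist (sum f Y) F < r)"
    have "(0::real) < (1 / 2) ^ N" by simp
    with * obtain X where "finite X" "X \<subseteq> A" "\<And>Y. finite Y \<and> X \<subseteq> Y \<and> Y \<subseteq> A \<Longrightarrow> dist (sum f Y) F < (1 / 2) ^ N"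
      by meson
    then show "\<exists>X0. finite X0 \<and> X0 \<subseteq> A \<and> (\<forall>X. finite X \<and> X0 \<subseteq> X \<and> X \<subseteq> A \<longrightarrow> sum f X - F \<in> ordge (int N))"
      using 2 by meson
  next
    fix r :: real assume "r > 0"
    then obtain N where "(1 / 2) ^ N < r" using real_arch_pow_inv[of r "1 / 2"] by auto
    moreover assume "\<forall>N::nat. \<exists>X0. finite X0 \<and> X0 \<subseteq> A \<and>
     (\<forall>X. finite X \<and> X0 \<subseteq> X \<and> X \<subseteq> A \<longrightarrow> sum f X - F \<in> ordge (int N))"
    ultimately show "\<exists>X. finite X \<and> X \<subseteq> A \<and> (\<forall>Y. finite Y \<and> X \<subseteq> Y \<and> Y \<subseteq> A \<longrightarrow> dist (sum f Y) F < r)"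
      using 1 by meson
  qed
qed

lemma fls_nth_sum: "sum f X $$ j = (\<Sum>i\<in>X. f i $$ j)"
  by (induction X rule: infinite_finite_induct) auto

lemma has_sum_fls_nth:
  fixes f :: "'a \<Rightarrow> 'b::field fls"
  assumes "(f has_sum F) A"
  shows "\<exists>X. finite X \<and> X \<subseteq> A \<and> F $$ j = (\<Sum>i\<in>X. f i $$ j)"
proof -
  obtain X where X: "finite X" "X \<subseteq> A" "sum f X - F \<in> ordge (int (nat (j + 1)))"
    using assms unfolding has_sum_fls_iff by blast
  have "(sum f X - F) $$ j = 0" by (rule ordgeD[OF X(3)]) simp
  then have "F $$ j = (\<Sum>i\<in>X. f i $$ j)" by (simp add: fls_nth_sum)
  then show ?thesis using X by blast
qed

section \<open>Numerical semigroups: atoms, minimal generators, semigroup rings\<close>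

definition irreducibles :: "nat set \<Rightarrow> nat set" where
  "irreducibles H = {h \<in> H - {0}. \<forall>a\<in>H - {0}. \<forall>b\<in>H - {0}. h \<noteq> a + b}"

locale numerical_semigroup =
  fixes H :: "nat set"
  assumes zero: "0 \<in> H" and add: "\<And>g h. g \<in> H \<Longrightarrow> h \<in> H \<Longrightarrow> g + h \<in> H"
    and cofinite: "\<exists>c. {c..} \<subseteq> H"
begin

lemma submonoid_gen_subset: "B \<subseteq> H \<Longrightarrow> submonoid_gen B \<subseteq> H"
proof
  fix h assume "B \<subseteq> H" "h \<in> submonoid_gen B"
  show "h \<in> H" using \<open>h \<in> submonoid_gen B\<close> \<open>B \<subseteq> H\<close> by induction (auto intro: zero add)
qed

lemma submonoid_gen_add:
  "g \<in> submonoid_gen B \<Longrightarrow> h \<in> submonoid_gen B \<Longrightarrow> g + h \<in> submonoid_gen B"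
  by (induction rule: submonoid_gen.induct) (auto simp: add.assoc intro: submonoid_gen.add)

lemma submonoid_gen_irreducibles: "submonoid_gen (irreducibles H) = H"
proof
  show "submonoid_gen (irreducibles H) \<subseteq> H"
    by (rule submonoid_gen_subset) (auto simp: irreducibles_def)
  have "h \<in> H \<Longrightarrow> h \<in> submonoid_gen (irreducibles H)" for h
  proof (induction h rule: less_induct)
    case (less h)
    consider "h = 0" | "h \<in> irreducibles H" | a b where "a \<in> H - {0}" "b \<in> H - {0}" "h = a + b"
      using less.prems unfolding irreducibles_def by blast
    then show ?case
    proof cases
      case 1
      then show ?thesis by (simp add: submonoid_gen.zero)
    next
      case 2
      from submonoid_gen.add[OF this submonoid_gen.zero] show ?thesis by simp
    next
      case 3
      then have "a \<in> submonoid_gen (irreducibles H)" "b \<in> submonoid_gen (irreducibles H)"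
        using less.IH by auto
      then show ?thesis using 3 by (simp add: submonoid_gen_add)
    qed
  qed
  then show "H \<subseteq> submonoid_gen (irreducibles H)" by blast
qed

lemma irreducibles_subset_generators:
  assumes "submonoid_gen B = H"
  shows "irreducibles H \<subseteq> B"
proof
  \<comment> \<open>A generating set may contain 0, so a nonzero generator is split off.\<close>
  have split: "h \<noteq> 0 \<Longrightarrow> \<exists>b\<in>B. \<exists>h'\<in>submonoid_gen B. b \<noteq> 0 \<and> h = b + h'" if "h \<in> submonoid_gen B" for h
    using that
  proof induction
    case (add b h)
    then show ?case by (cases "b = 0") auto
  qed simp
  fix h assume h: "h \<in> irreducibles H"
  then obtain b h' where b: "b \<in> B" "h' \<in> H" "b \<noteq> 0" "h = b + h'"
    using split[of h] assms unfolding irreducibles_def by blast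
  moreover have "b \<in> H" using submonoid_gen.add[OF b(1) submonoid_gen.zero] assms by simp
  ultimately have "h' = 0" using h unfolding irreducibles_def by blast
  then show "h \<in> B" using b by simp
qed

text \<open>The atoms generate \<open>H\<close> and lie in every generating set, so they are its
  only minimal one; this gives the definite description in \<open>min_gens\<close> its
  value.\<close>

lemma min_gens_eq: "min_gens H = irreducibles H"
  unfolding min_gens_def
proof (rule the_equality)
  show "submonoid_gen (irreducibles H) = H \<and> (\<forall>B'. B' \<subset> irreducibles H \<longrightarrow> submonoid_gen B' \<noteq> H)"
    using submonoid_gen_irreducibles irreducibles_subset_generators by blast
  fix B assume "submonoid_gen B = H \<and> (\<forall>B'. B' \<subset> B \<longrightarrow> submonoid_gen B' \<noteq> H)"
  then show "B = irreducibles H"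
    using submonoid_gen_irreducibles irreducibles_subset_generators by blast
qed

lemma finite_irreducibles: "finite (irreducibles H)"
proof -
  obtain c where c: "{c..} \<subseteq> H" using cofinite by blast
  have "irreducibles H \<subseteq> {..<Suc c + Suc c}"
  proof
    fix h assume h: "h \<in> irreducibles H"
    show "h \<in> {..<Suc c + Suc c}"
    proof (rule ccontr)
      assume "h \<notin> {..<Suc c + Suc c}"
      \<comment> \<open>\<open>Suc c\<close> instead of \<open>c\<close> keeps both summands nonzero
        also for \<open>c = 0\<close>.\<close>
      then have "h = Suc c + (h - Suc c)" "c \<le> h - Suc c" "h - Suc c \<noteq> 0" by auto
      moreover have "Suc c \<in> H - {0}" "h - Suc c \<in> H - {0}" using c calculation by auto
      ultimately show False using h unfolding irreducibles_def by blast
    qed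
  qed
  then show ?thesis by (rule finite_subset) simp
qed

text \<open>The least nonzero element cannot be a sum of two nonzero ones, so it is an atom. Hence
  the distinguished parameter of \<open>k[[H]]\<close> is \<open>t^e\<close>.\<close>

lemma Min_min_gens:
  assumes e: "e \<in> H" "0 < e" "\<And>h. h \<in> H - {0} \<Longrightarrow> e \<le> h"
  shows "Min (min_gens H) = e"
  unfolding min_gens_eq
proof (rule Min_eqI[OF finite_irreducibles])
  show "e \<in> irreducibles H" unfolding irreducibles_def
  proof (intro CollectI conjI ballI)
    fix a b assume ab: "a \<in> H - {0}" "b \<in> H - {0}"
    then have "e \<le> a" "0 < b" using e(3) by auto
    then show "e \<noteq> a + b" by simp
  qed (use e in auto)
qed (use e in \<open>auto simp: irreducibles_def\<close>)

lemma sum_mult_closed: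
  assumes "B \<subseteq> H"
  shows "(\<Sum>b\<in>B. b * k b) \<in> H"
proof -
  have "b * m \<in> H" if "b \<in> H" for b m
    using that by (induction m) (auto intro: zero add)
  then show ?thesis using assms
    by (induction B rule: infinite_finite_induct) (auto intro: zero add)
qed

lemma exponents_exist:
  assumes "h \<in> submonoid_gen B" "finite B"
  shows "\<exists>\<alpha>\<in>exponents B. (\<Sum>b\<in>B. b * \<alpha> b) = h"
  using assms(1)
proof induction
  case zero
  then show ?case by (intro bexI[of _ "\<lambda>_. 0"]) (auto simp: exponents_def)
next
  case (add b h)
  then obtain \<alpha> where \<alpha>: "\<alpha> \<in> exponents B" "(\<Sum>b\<in>B. b * \<alpha> b) = h" by blast
  have "(\<Sum>i\<in>B. i * (\<alpha>(b := Suc (\<alpha> b))) i) = (\<Sum>i\<in>B. (if i = b then b else 0) + i * \<alpha> i)"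
    by (rule sum.cong) auto
  also have "\<dots> = b + h" using assms(2) add.hyps(1) \<alpha>(2) by (simp add: sum.distrib)
  finally show ?case using \<alpha>(1) add.hyps(1)
    by (intro bexI[of _ "\<alpha>(b := Suc (\<alpha> b))"]) (auto simp: exponents_def)
qed

text \<open>A series with support in \<open>H\<close> is expanded by choosing one factorisation of every element of \<open>H\<close>.\<close>

lemma semigroup_ring_eq:
  "semigroup_ring H = {f :: 'k::field fls. \<forall>j. f $$ j \<noteq> 0 \<longrightarrow> 0 \<le> j \<and> nat j \<in> H}"
proof -
  define B where "B = irreducibles H"
  have B: "finite B" "B \<subseteq> H" "submonoid_gen B = H"
    unfolding B_def using finite_irreducibles submonoid_gen_irreducibles by (auto simp: irreducibles_def)
  define w where "w \<alpha> = (\<Sum>b\<in>B. b * \<alpha> b)" for \<alpha> :: "nat \<Rightarrow> nat"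
  have wH: "w \<alpha> \<in> H" for \<alpha> unfolding w_def by (rule sum_mult_closed[OF B(2)])
  have mono: "(\<Prod>b\<in>B. (fls_X ^ b) ^ \<alpha> b) = (fls_X :: 'k fls) ^ w \<alpha>" for \<alpha>
    unfolding w_def by (simp add: power_sum power_mult)
  have S: "semigroup_ring H = {f :: 'k fls. \<exists>k. ((\<lambda>\<alpha>. fls_const (k \<alpha>) * fls_X ^ w \<alpha>) has_sum f) (exponents B)}"
    unfolding semigroup_ring_def power_series_ring_def power_series_value_def min_gens_eq B_def[symmetric] mono ..
  show ?thesis
  proof (rule equalityI; rule subsetI)
    fix f :: "'k fls" assume "f \<in> semigroup_ring H"
    then obtain k where k: "((\<lambda>\<alpha>. fls_const (k \<alpha>) * fls_X ^ w \<alpha>) has_sum f) (exponents B)"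
      unfolding S by blast
    have "0 \<le> j \<and> nat j \<in> H" if "f $$ j \<noteq> 0" for j
    proof -
      obtain X where "f $$ j = (\<Sum>\<alpha>\<in>X. (fls_const (k \<alpha>) * fls_X ^ w \<alpha>) $$ j)"
        using has_sum_fls_nth[OF k] by blast
      with that have "(\<Sum>\<alpha>\<in>X. (fls_const (k \<alpha>) * fls_X ^ w \<alpha>) $$ j) \<noteq> 0" by simp
      then obtain \<alpha> where "(fls_const (k \<alpha>) * fls_X ^ w \<alpha>) $$ j \<noteq> 0"
        by (rule sum.not_neutral_contains_not_neutral)
      then have "j = int (w \<alpha>)" by (auto split: if_splits)
      then show ?thesis using wH by simp
    qed
    then show "f \<in> {f. \<forall>j. f $$ j \<noteq> 0 \<longrightarrow> 0 \<le> j \<and> nat j \<in> H}" by blast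
  next
    fix f :: "'k fls" assume "f \<in> {f. \<forall>j. f $$ j \<noteq> 0 \<longrightarrow> 0 \<le> j \<and> nat j \<in> H}"
    then have f: "\<And>j. f $$ j \<noteq> 0 \<Longrightarrow> 0 \<le> j \<and> nat j \<in> H" by blast
    have "\<forall>h\<in>H. \<exists>\<alpha>\<in>exponents B. w \<alpha> = h"
      using exponents_exist[OF _ B(1)] B(3) unfolding w_def by blast
    then obtain a where a: "\<And>h. h \<in> H \<Longrightarrow> a h \<in> exponents B" "\<And>h. h \<in> H \<Longrightarrow> w (a h) = h" by metis
    define k where "k \<alpha> = (if \<alpha> \<in> a ` H then f $$ int (w \<alpha>) else 0)" for \<alpha>
    have "((\<lambda>\<alpha>. fls_const (k \<alpha>) * fls_X ^ w \<alpha>) has_sum f) (exponents B)"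
      unfolding has_sum_fls_iff
    proof (intro allI exI conjI impI)
      fix N :: nat
      \<comment> \<open>The chosen factorisations of the elements below \<open>N\<close> carry all
        terms of order below \<open>N\<close>.\<close>
      show "finite (a ` (H \<inter> {..<N}))" "a ` (H \<inter> {..<N}) \<subseteq> exponents B" using a by auto
      fix X assume X: "finite X \<and> a ` (H \<inter> {..<N}) \<subseteq> X \<and> X \<subseteq> exponents B"
      show "(\<Sum>\<alpha>\<in>X. fls_const (k \<alpha>) * fls_X ^ w \<alpha>) - f \<in> ordge (int N)" unfolding ordge_def
      proof (intro CollectI allI impI)
        fix j assume j: "j < int N"
        have "(\<Sum>\<alpha>\<in>X. (fls_const (k \<alpha>) * fls_X ^ w \<alpha>) $$ j) = f $$ j"
        proof (cases "0 \<le> j \<and> nat j \<in> H")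
          case False
          then have "f $$ j = 0" using f by blast
          moreover have "(fls_const (k \<alpha>) * fls_X ^ w \<alpha>) $$ j = 0" for \<alpha>
            using False wH by auto
          ultimately show ?thesis by (simp add: sum.neutral)
        next
          case True
          have zero: "(fls_const (k \<alpha>) * fls_X ^ w \<alpha>) $$ j = 0" if "\<alpha> \<noteq> a (nat j)" for \<alpha>
            using that a(2) by (auto simp: k_def)
          have "nat j \<in> H \<inter> {..<N}" using True j by auto
          then have aX: "a (nat j) \<in> X" using X by blast
          have "(\<Sum>\<alpha>\<in>X. (fls_const (k \<alpha>) * fls_X ^ w \<alpha>) $$ j) = (fls_const (k (a (nat j))) * fls_X ^ w (a (nat j))) $$ j"
          proof -
            have "(\<Sum>\<alpha>\<in>X - {a (nat j)}. (fls_const (k \<alpha>) * fls_X ^ w \<alpha>) $$ j) = 0"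
              using zero by (intro sum.neutral) blast
            then show ?thesis using X aX by (simp only: sum.remove[of X "a (nat j)"] add_0_right)
          qed
          also have "\<dots> = f $$ j" using True a(2)[of "nat j"] by (simp add: k_def)
          finally show ?thesis .
        qed
        then show "((\<Sum>\<alpha>\<in>X. fls_const (k \<alpha>) * fls_X ^ w \<alpha>) - f) $$ j = 0" by (simp add: fls_nth_sum)
      qed
    qed
    then show "f \<in> semigroup_ring H" unfolding S by blast
  qed
qed

lemma X_power_semigroup_ring: "h \<in> H \<Longrightarrow> fls_X ^ h \<in> semigroup_ring H"
  by (auto simp: semigroup_ring_eq)

lemma val_ring_semigroup_ring: "val_ring (semigroup_ring H :: 'k::field fls set)"
proof
  show "semigroup_ring H \<subseteq> (ordge 0 :: 'k fls set)" unfolding semigroup_ring_eq ordge_def by force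
  show "fls_const a \<in> semigroup_ring H" for a :: 'k by (auto simp: semigroup_ring_eq zero)
  show "\<exists>N::nat. ordge (int N) \<subseteq> (semigroup_ring H :: 'k fls set)"
  proof -
    obtain c where c: "{c..} \<subseteq> H" using cofinite by blast
    have "f \<in> semigroup_ring H" if f: "f \<in> ordge (int c)" for f :: "'k fls"
      unfolding semigroup_ring_eq
    proof (intro CollectI allI impI)
      fix j assume "f $$ j \<noteq> 0"
      then have "int c \<le> j" using ordgeD[OF f, of j] by (meson not_le)
      then show "0 \<le> j \<and> nat j \<in> H" using c by (auto simp: subset_iff le_nat_iff)
    qed
    then show ?thesis by blast
  qed
  fix f g :: "'k fls" assume fg: "f \<in> semigroup_ring H" "g \<in> semigroup_ring H"
  show "f + g \<in> semigroup_ring H" unfolding semigroup_ring_eq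
  proof (intro CollectI allI impI)
    fix j assume "(f + g) $$ j \<noteq> 0"
    then have "f $$ j \<noteq> 0 \<or> g $$ j \<noteq> 0" by auto
    then show "0 \<le> j \<and> nat j \<in> H" using fg unfolding semigroup_ring_eq by blast
  qed
  show "f * g \<in> semigroup_ring H" unfolding semigroup_ring_eq
  proof (intro CollectI allI impI)
    fix j assume "(f * g) $$ j \<noteq> 0"
    then obtain i where "f $$ i * g $$ (j - i) \<noteq> 0"
      unfolding fls_times_nth(2) by (rule sum.not_neutral_contains_not_neutral)
    then have i: "0 \<le> i" "nat i \<in> H" "0 \<le> j - i" "nat (j - i) \<in> H"
      using fg unfolding semigroup_ring_eq by auto
    then have "nat j = nat i + nat (j - i)" by simp
    then show "0 \<le> j \<and> nat j \<in> H" using add i by simp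
  qed
qed

lemma val_semigroup_ring: "val_semigroup (semigroup_ring H :: 'k::field fls set) = H"
proof
  show "val_semigroup (semigroup_ring H :: 'k fls set) \<subseteq> H"
  proof
    fix v assume "v \<in> val_semigroup (semigroup_ring H :: 'k fls set)"
    then obtain f where "f \<in> (semigroup_ring H :: 'k fls set)" "f $$ int v \<noteq> 0" unfolding val_iff by blast
    then show "v \<in> H" unfolding semigroup_ring_eq by force
  qed
  show "H \<subseteq> val_semigroup (semigroup_ring H :: 'k fls set)"
  proof
    fix h assume "h \<in> H"
    then have "(fls_X :: 'k fls) ^ h \<in> semigroup_ring H" by (rule X_power_semigroup_ring)
    then show "h \<in> val_semigroup (semigroup_ring H :: 'k fls set)"
      unfolding val_semigroup_def by (intro CollectI bexI[of _ "fls_X ^ h"]) auto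
  qed
qed

lemma val_ring_param_semigroup_ring:
  assumes e: "e \<in> H" "0 < e" "\<And>h. h \<in> H - {0} \<Longrightarrow> e \<le> h"
  shows "val_ring_param (semigroup_ring H) (fls_X ^ e :: 'k::field fls) e"
proof -
  interpret val_ring "semigroup_ring H :: 'k fls set" by (rule val_ring_semigroup_ring)
  show ?thesis
    by unfold_locales (use e X_power_semigroup_ring val_semigroup_ring[where 'k = 'k] in auto)
qed

text \<open>In \<open>k[[H]]\<close> the monomial \<open>t^v\<close> itself lies in the socle: for
  \<open>y\<close> in the maximal ideal all exponents of \<open>t^v y\<close> are in
  \<open>e + H\<close>. A general \<open>R\<close> need not contain monomials, hence only the
  inclusion \<open>val_socle\<close> there.\<close>

lemma val_socle_semigroup_ring:
  assumes e: "e \<in> H" "0 < e" "\<And>h. h \<in> H - {0} \<Longrightarrow> e \<le> h"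
  shows "val_semigroup (val_ring_param.socle (semigroup_ring H) (fls_X ^ e :: 'k::field fls)) = socle_vals H e"
proof -
  interpret val_ring_param "semigroup_ring H" "fls_X ^ e :: 'k fls" e
    by (rule val_ring_param_semigroup_ring[OF e])
  show ?thesis
  proof
    show "val_semigroup socle \<subseteq> socle_vals H e" using val_socle unfolding val_semigroup_ring .
    show "socle_vals H e \<subseteq> val_semigroup socle"
    proof
      fix v assume v: "v \<in> socle_vals H e"
      have "fls_X ^ v * y \<in> principal (semigroup_ring H) (fls_X ^ e)"
        if y: "y \<in> max_ideal (semigroup_ring H)" for y :: "'k fls"
      proof -
        \<comment> \<open>\<open>fls_shift\<close> lowers exponents, so this is
          \<open>t^(v - e) y\<close>, the quotient of \<open>t^v y\<close> by
          \<open>t^e\<close>.\<close>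
        define g where "g = fls_shift (int e - int v) y"
        have "g \<in> semigroup_ring H" unfolding semigroup_ring_eq
        proof (intro CollectI allI impI)
          fix j assume "g $$ j \<noteq> 0"
          then have yj: "y $$ (j + int e - int v) \<noteq> 0" unfolding g_def by (simp add: algebra_simps)
          define i where "i = j + int e - int v"
          have "y \<in> ordge 1" "y \<in> semigroup_ring H" using y unfolding max_ideal_eq by auto
          then have i: "1 \<le> i" "nat i \<in> H"
            using yj unfolding i_def[symmetric] semigroup_ring_eq ordge_def by force+
          then have "v + nat i \<in> (+) e ` H" using v unfolding socle_vals_def by auto
          then have "e \<le> v + nat i" "v + nat i - e \<in> H" by (auto simp: mem_translate)
          moreover have "j = int (v + nat i - e)" using calculation(1) i(1) unfolding i_def by (simp add: of_nat_diff)
          ultimately show "0 \<le> j \<and> nat j \<in> H" by (metis nat_int of_nat_0_le_iff)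
        qed
        moreover have "fls_X ^ v * y = fls_X ^ e * g"
          by (simp add: g_def fls_X_power_times_conv_shift)
        ultimately show ?thesis unfolding principal_def by blast
      qed
      moreover have "fls_X ^ v \<in> (semigroup_ring H :: 'k fls set)"
        using v X_power_semigroup_ring unfolding socle_vals_def by blast
      ultimately have "(fls_X :: 'k fls) ^ v \<in> socle" unfolding socle_def by blast
      then show "v \<in> val_semigroup socle"
        unfolding val_semigroup_def by (intro CollectI bexI[of _ "fls_X ^ v"]) auto
    qed
  qed
qed

end

subsection \<open>Subrings with normalization \<open>k[[t]]\<close>\<close>

lemma ordge_prod: "(\<And>i. i \<in> I \<Longrightarrow> f i \<in> ordge 0) \<Longrightarrow> prod f I \<in> ordge 0"
proof (induction I rule: infinite_finite_induct)
  case (insert i I)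
  then show ?case using ordge_mult[of "f i" 0 "prod f I" 0] by simp
qed (use const_ordge[of 1] in auto)

text \<open>Terms of index above \<open>j\<close> do not affect the coefficient at \<open>j\<close>,
  so this coefficient of the limit is taken from the partial sum of length
  \<open>Suc j\<close>.\<close>

lemma geometric_limit:
  fixes z :: "'k::field fls" and d :: "nat \<Rightarrow> 'k"
  assumes z: "z \<in> ordge 1"
  shows "\<exists>Z. \<forall>M. Z - (\<Sum>m<M. fls_const (d m) * z ^ m) \<in> ordge (int M)"
proof -
  define p where "p M = (\<Sum>m<M. fls_const (d m) * z ^ m)" for M
  define Z where "Z = fps_to_fls (Abs_fps (\<lambda>j. p (Suc j) $$ int j))"
  have zm: "fls_const (d m) * z ^ m \<in> ordge (int m)" for m
    using ordge_const_mult[OF ordge_power[OF z, of m]] by simp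
  have p0: "p M \<in> ordge 0" for M
    unfolding p_def by (rule ordge_sum, rule ordge_mono[OF zm]) simp
  have "Z - p M \<in> ordge (int M)" for M unfolding ordge_def
  proof (intro CollectI allI impI)
    fix j assume j: "j < int M"
    show "(Z - p M) $$ j = 0"
    proof (cases "j < 0")
      case True
      then show ?thesis using ordgeD[OF p0 True] by (simp add: Z_def)
    next
      case False
      have "p M = p (Suc (nat j)) + (\<Sum>m=Suc (nat j)..<M. fls_const (d m) * z ^ m)"
        unfolding p_def lessThan_atLeast0 using j False
        by (intro sum.atLeastLessThan_concat[symmetric]) auto
      moreover have "(\<Sum>m=Suc (nat j)..<M. fls_const (d m) * z ^ m) \<in> ordge (int (Suc (nat j)))"
        by (rule ordge_sum, rule ordge_mono[OF zm]) auto
      from ordgeD[OF this, of j] have "(\<Sum>m=Suc (nat j)..<M. fls_const (d m) * z ^ m) $$ j = 0" using False by simp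
      ultimately show ?thesis using False by (simp add: Z_def)
    qed
  qed
  then show ?thesis unfolding p_def by blast
qed

text \<open>A power series in \<open>x s\<close> is one in all generators, with nonzero coefficients
  only at exponents concentrated in \<open>s\<close>. In this form the presentation supplies
  completeness.\<close>

lemma power_series_ring_geometric:
  fixes x :: "nat \<Rightarrow> 'k::field fls" and d :: "nat \<Rightarrow> 'k"
  assumes J: "finite J" "s \<in> J" and Z: "\<And>M. Z - (\<Sum>m<M. fls_const (d m) * x s ^ m) \<in> ordge (int M)"
    and xs: "x s \<in> ordge 1"
  shows "Z \<in> power_series_ring J x"
proof -
  define single where "single m = (\<lambda>i. if i = s then m else 0)" for m :: nat
  have inj: "inj_on single K" for K by (rule inj_onI) (metis single_def)
  define k where "k \<alpha> = (if \<alpha> \<in> range single then d (\<alpha> s) else 0)" for \<alpha>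
  define T where "T \<alpha> = fls_const (k \<alpha>) * (\<Prod>i\<in>J. x i ^ \<alpha> i)" for \<alpha>
  have Ts: "T (single m) = fls_const (d m) * x s ^ m" for m
  proof -
    have "(\<Prod>i\<in>J. x i ^ single m i) = (\<Prod>i\<in>J. if i = s then x s ^ m else 1)"
      by (rule prod.cong) (auto simp: single_def)
    also have "\<dots> = x s ^ m" using J by simp
    finally show ?thesis unfolding T_def k_def by (simp add: single_def)
  qed
  have "(T has_sum Z) (exponents J)" unfolding has_sum_fls_iff
  proof (intro allI exI conjI impI)
    fix N :: nat
    show "finite (single ` {..<N})" "single ` {..<N} \<subseteq> exponents J"
      using J(2) by (auto simp: exponents_def single_def)
    fix X assume X: "finite X \<and> single ` {..<N} \<subseteq> X \<and> X \<subseteq> exponents J"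
    have "sum T X = sum T (X - single ` {..<N}) + sum T (single ` {..<N})"
      using X by (intro sum.subset_diff) auto
    also have "sum T (single ` {..<N}) = (\<Sum>m<N. fls_const (d m) * x s ^ m)"
      by (simp add: sum.reindex[OF inj] Ts)
    finally have "sum T X - Z = sum T (X - single ` {..<N}) - (Z - (\<Sum>m<N. fls_const (d m) * x s ^ m))" by simp
    also have "\<dots> \<in> ordge (int N)"
    proof (rule ordge_diff[OF ordge_sum Z])
      fix \<alpha> assume \<alpha>: "\<alpha> \<in> X - single ` {..<N}"
      show "T \<alpha> \<in> ordge (int N)"
      proof (cases "\<alpha> \<in> range single")
        case True
        then obtain m where m: "\<alpha> = single m" by blast
        then have "N \<le> m" using \<alpha> by (meson DiffD2 imageI lessThan_iff not_le)
        have "x s ^ m \<in> ordge (int m)" using ordge_power[OF xs, of m] by simp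
        then have "x s ^ m \<in> ordge (int N)" by (rule ordge_mono) (use \<open>N \<le> m\<close> in simp)
        then show ?thesis unfolding m Ts by (rule ordge_const_mult)
      qed (simp add: T_def k_def)
    qed
    finally show "sum T X - Z \<in> ordge (int N)" .
  qed
  then show ?thesis unfolding power_series_ring_def power_series_value_def T_def by blast
qed

text \<open>The uniformizer is a quotient \<open>p/q\<close>, and the orders of \<open>p\<close> and \<open>q\<close> are consecutive numbers.\<close>

lemma all_large_orders:
  assumes A: "A \<subseteq> ordge 0" "1 \<in> A" "\<And>f g. f \<in> A \<Longrightarrow> g \<in> A \<Longrightarrow> f * g \<in> A"
    and X: "fls_X \<in> frac_field A"
  shows "\<exists>N::nat. \<forall>j\<ge>N. \<exists>r\<in>A. r \<noteq> 0 \<and> fls_subdegree (r :: 'k::field fls) = int j"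
proof -
  have pow: "f ^ n \<in> A" if "f \<in> A" for f n using that A(2,3) by (induction n) auto
  obtain p q where pq: "fls_X = p / q" "p \<in> A" "q \<in> A" "q \<noteq> 0" using X unfolding frac_field_def by blast
  then have p: "p = fls_X * q" using nonzero_eq_divide_eq[OF pq(4), of fls_X p] pq(1) by simp
  then have p0: "p \<noteq> 0" using pq(4) by simp
  define m where "m = nat (fls_subdegree q)"
  have q: "fls_subdegree q = int m" unfolding m_def using A(1) pq(3,4) by (auto simp: ordge_iff)
  have sp: "fls_subdegree p = int (Suc m)" unfolding p using pq(4) q by (subst fls_subdegree_mult) auto
  \<comment> \<open>With \<open>q\<close> of order \<open>m\<close> and \<open>p\<close> of order
    \<open>m + 1\<close>, the number \<open>m s + r\<close> is the order of
    \<open>q ^ (s - r) * p ^ r\<close> whenever \<open>r \<le> s\<close>; for a remainder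
    \<open>r < m\<close> the bound \<open>m * m\<close> ensures this.\<close>
  have "\<exists>r\<in>A. r \<noteq> 0 \<and> fls_subdegree r = int j" if j: "m * m \<le> j" for j
  proof (cases "m = 0")
    case True
    then show ?thesis using pow[OF pq(2), of j] p0 sp by (intro bexI[of _ "p ^ j"]) (auto simp: fls_subdegree_pow)
  next
    case False
    define r where "r = j mod m"
    define s where "s = j div m"
    have "m \<le> s" unfolding s_def using j False by (simp add: less_eq_div_iff_mult_less_eq)
    moreover have "r < m" unfolding r_def using False by simp
    ultimately have "r \<le> s" by simp
    have "j = m * s + r" unfolding r_def s_def by simp
    also have "\<dots> = m * (s - r) + r * Suc m" using \<open>r \<le> s\<close> by (simp add: diff_mult_distrib2 algebra_simps)
    finally have j: "int j = int (s - r) * int m + int r * int (Suc m)"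
      by (simp only: of_nat_add of_nat_mult mult.commute)
    have "fls_subdegree (q ^ (s - r) * p ^ r) = int j"
      unfolding j using pq(4) p0 q sp by (simp add: fls_subdegree_pow)
    then show ?thesis using pow pq p0 A(3) by (intro bexI[of _ "q ^ (s - r) * p ^ r"]) auto
  qed
  then show ?thesis by blast
qed

text \<open>Greedy expansion of \<open>f\<close> in elements \<open>u j\<close> of order
  \<open>N + j\<close>: step \<open>j\<close> removes the coefficient at \<open>N + j\<close>, so
  \<open>M\<close> steps leave order at least \<open>N + M\<close>.\<close>

primrec remainder :: "(nat \<Rightarrow> 'k::field fls) \<Rightarrow> nat \<Rightarrow> 'k fls \<Rightarrow> nat \<Rightarrow> 'k fls" where
  "remainder u N f 0 = f"
| "remainder u N f (Suc j) = remainder u N f j -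
     fls_const (remainder u N f j $$ int (N + j) / u j $$ int (N + j)) * u j"

lemma expansion_exists:
  fixes f :: "'k::field fls"
  assumes u: "\<And>j. u j \<noteq> 0 \<and> fls_subdegree (u j) = int (N + j)" and f: "f \<in> ordge (int N)"
  shows "\<exists>d. \<forall>M. f - (\<Sum>j<M. fls_const (d j) * u j) \<in> ordge (int (N + M))"
proof -
  let ?d = "\<lambda>j. remainder u N f j $$ int (N + j) / u j $$ int (N + j)"
  have "remainder u N f M = f - (\<Sum>j<M. fls_const (?d j) * u j)" for M
    by (induction M) simp_all
  moreover have "remainder u N f M \<in> ordge (int (N + M))" for M
  proof (induction M)
    case (Suc M)
    have uo: "u M \<in> ordge (int (N + M))" using u[of M] by (simp add: ordge_iff)
    have u0: "u M $$ int (N + M) \<noteq> 0" using u[of M] nth_fls_subdegree_nonzero[of "u M"] by auto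
    show ?case unfolding ordge_def
    proof (intro CollectI allI impI)
      fix j assume j: "j < int (N + Suc M)"
      show "remainder u N f (Suc M) $$ j = 0"
      proof (cases "j = int (N + M)")
        case True
        then show ?thesis using u0 by simp
      next
        case False
        then have "j < int (N + M)" using j by simp
        then show ?thesis using ordgeD[OF Suc.IH, of j] ordgeD[OF uo, of j] by simp
      qed
    qed
  qed (simp add: f)
  ultimately show ?thesis by (intro exI[of _ ?d] allI) metis
qed

text \<open>A series of large order is \<open>\<Sum>\<^sub>i g\<^sub>iZ\<^sub>i\<close> with \<open>g\<^sub>i\<close> in the ring of \<open>E\<close> consecutive orders and
  \<open>Z\<^sub>i\<close> a power series in \<open>z\<close>.\<close>

lemma tail_subset:
  fixes R :: "'k::field fls set"
  assumes R: "0 \<in> R" "1 \<in> R" "\<And>f g. f \<in> R \<Longrightarrow> g \<in> R \<Longrightarrow> f + g \<in> R" "\<And>f g. f \<in> R \<Longrightarrow> g \<in> R \<Longrightarrow> f * g \<in> R"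
    "R \<subseteq> ordge 0"
    and X: "fls_X \<in> frac_field R"
    and z: "z \<noteq> 0" "fls_subdegree z = int E" "0 < E"
    and geom: "\<And>Z d. (\<And>M. Z - (\<Sum>m<M. fls_const (d m) * z ^ m) \<in> ordge (int M)) \<Longrightarrow> Z \<in> R"
  shows "\<exists>N::nat. ordge (int N) \<subseteq> R"
proof -
  obtain N :: nat where N: "\<And>j. N \<le> j \<Longrightarrow> \<exists>r\<in>R. r \<noteq> 0 \<and> fls_subdegree r = int j"
    using all_large_orders[OF R(5,2,4) X] by blast
  then have "\<forall>i. \<exists>r\<in>R. r \<noteq> 0 \<and> fls_subdegree r = int (N + i)" by (intro allI) (rule N, simp)
  then obtain g where g: "\<And>i. g i \<in> R" "\<And>i. g i \<noteq> 0" "\<And>i. fls_subdegree (g i) = int (N + i)" by metis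
  have zo: "z \<in> ordge 1" using z by (simp add: ordge_iff)
  have "f \<in> R" if f: "f \<in> ordge (int N)" for f
  proof -
    \<comment> \<open>The \<open>E\<close> elements of consecutive orders from \<open>N\<close> on,
      moved up by powers of \<open>z\<close> of order \<open>E\<close>, meet each order from
      \<open>N\<close> on exactly once.\<close>
    define u where "u j = g (j mod E) * z ^ (j div E)" for j
    have "u j \<noteq> 0 \<and> fls_subdegree (u j) = int (N + j)" for j
    proof -
      have "fls_subdegree (u j) = int N + int (j mod E) + int (j div E) * int E"
        unfolding u_def using g z by (simp add: fls_subdegree_pow)
      also have "\<dots> = int (N + (j mod E + j div E * E))" by (simp only: of_nat_add of_nat_mult add.assoc)
      also have "j mod E + j div E * E = j" by simp
      finally have "fls_subdegree (u j) = int (N + j)" .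
      then show ?thesis using g(2) z(1) unfolding u_def by simp
    qed
    from expansion_exists[OF this f] obtain d where
      d: "\<And>M. f - (\<Sum>j<M. fls_const (d j) * u j) \<in> ordge (int (N + M))" by blast
    have "\<forall>i. \<exists>Z. \<forall>M. Z - (\<Sum>m<M. fls_const (d (m * E + i)) * z ^ m) \<in> ordge (int M)"
      by (intro allI geometric_limit[OF zo])
    then obtain Z where Z: "\<And>i M. Z i - (\<Sum>m<M. fls_const (d (m * E + i)) * z ^ m) \<in> ordge (int M)" by metis
    have ZR: "Z i \<in> R" for i by (rule geom[OF Z])
    \<comment> \<open>Summation up to a multiple of \<open>E\<close> allows regrouping by residues
      modulo \<open>E\<close>: one partial sum in powers of \<open>z\<close> for each
      \<open>i < E\<close>.\<close>
    have split: "(\<Sum>j<M * E. fls_const (d j) * u j) =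
      (\<Sum>i<E. g i * (\<Sum>m<M. fls_const (d (m * E + i)) * z ^ m))" for M
    proof -
      have "(\<Sum>j<M * E. fls_const (d j) * u j) = (\<Sum>m<M. \<Sum>j=m*E..<m*E+E. fls_const (d j) * u j)"
        by (rule sum.nat_group[symmetric])
      also have "\<dots> = (\<Sum>m<M. \<Sum>i<E. g i * (fls_const (d (m * E + i)) * z ^ m))"
      proof (rule sum.cong[OF refl])
        fix m
        have "(\<Sum>j=m*E..<m*E+E. fls_const (d j) * u j) = (\<Sum>i<E. fls_const (d (m * E + i)) * u (m * E + i))"
          by (subst sum.atLeastLessThan_shift_0) (simp add: lessThan_atLeast0)
        also have "\<dots> = (\<Sum>i<E. g i * (fls_const (d (m * E + i)) * z ^ m))"
          by (rule sum.cong) (auto simp: u_def)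
        finally show "(\<Sum>j=m*E..<m*E+E. fls_const (d j) * u j) = \<dots>" .
      qed
      also have "\<dots> = (\<Sum>i<E. g i * (\<Sum>m<M. fls_const (d (m * E + i)) * z ^ m))"
        by (subst sum.swap) (simp add: sum_distrib_left)
      finally show ?thesis .
    qed
    have "f - (\<Sum>i<E. g i * Z i) \<in> ordge (int M)" for M
    proof -
      have "f - (\<Sum>i<E. g i * Z i) = (f - (\<Sum>j<M * E. fls_const (d j) * u j)) -
        (\<Sum>i<E. g i * (Z i - (\<Sum>m<M. fls_const (d (m * E + i)) * z ^ m)))"
        unfolding split by (simp add: right_diff_distrib sum_subtractf)
      also have "\<dots> \<in> ordge (int M)"
      proof (rule ordge_diff[OF _ ordge_sum])
        have "M \<le> M * E" using z(3) by simp
        then have "int M \<le> int (N + M * E)" by linarith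
        then show "f - (\<Sum>j<M * E. fls_const (d j) * u j) \<in> ordge (int M)" by (rule ordge_mono[OF d])
        fix i
        have "g i \<in> ordge 0" using g(1) R(5) by blast
        from ordge_mult[OF this Z[of i M]]
        show "g i * (Z i - (\<Sum>m<M. fls_const (d (m * E + i)) * z ^ m)) \<in> ordge (int M)" by simp
      qed
      finally show ?thesis .
    qed
    then have "f = (\<Sum>i<E. g i * Z i)" using ordge_eq0 by force
    also have "\<dots> \<in> R" using g(1) ZR R by (induction E) auto
    finally show ?thesis .
  qed
  then show ?thesis by blast
qed

section \<open>From the presentation to the locale assumptions\<close>

lemma order_of_presentation:
  fixes x :: "nat \<Rightarrow> 'k::field fls"
  assumes r: "r \<in> power_series_ring J x" and J: "finite J"
    and x: "\<And>i. i \<in> J \<Longrightarrow> x i \<in> ordge (int e)" and j: "0 < j" "j < int e"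
  shows "r $$ j = 0"
proof -
  obtain k where k: "((\<lambda>\<alpha>. fls_const (k \<alpha>) * (\<Prod>i\<in>J. x i ^ \<alpha> i)) has_sum r) (exponents J)"
    using r unfolding power_series_ring_def power_series_value_def by blast
  have x0: "x i ^ m \<in> ordge 0" if "i \<in> J" for i m
    using ordge_power[OF x[OF that], of m] by (rule ordge_mono) simp
  \<comment> \<open>A monomial is either 1 or contains some factor \<open>x s\<close> and so has
    order at least \<open>e\<close>; no term contributes strictly between 0 and \<open>e\<close>.
    This will make \<open>a 1\<close> the least nonzero value.\<close>
  have "(fls_const (k \<alpha>) * (\<Prod>i\<in>J. x i ^ \<alpha> i)) $$ j = 0" for \<alpha>
  proof (cases "\<exists>s\<in>J. \<alpha> s \<noteq> 0")
    case True
    then obtain s m where s: "s \<in> J" "\<alpha> s = Suc m" using not0_implies_Suc by blast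
    have "(\<Prod>i\<in>J - {s}. x i ^ \<alpha> i) \<in> ordge 0" using x0 by (intro ordge_prod) auto
    from ordge_mult[OF x0[OF s(1), of m] this]
    have "x s * (x s ^ m * (\<Prod>i\<in>J - {s}. x i ^ \<alpha> i)) \<in> ordge (int e)"
      using ordge_mult[OF x[OF s(1)]] by fastforce
    then have "(\<Prod>i\<in>J. x i ^ \<alpha> i) \<in> ordge (int e)"
      using J s by (simp add: prod.remove[of J s] mult.assoc)
    then show ?thesis using ordgeD j(2) by fastforce
  next
    case False
    then have "(\<Prod>i\<in>J. x i ^ \<alpha> i) = 1" by (intro prod.neutral) auto
    then show ?thesis using j(1) by simp
  qed
  then show ?thesis using has_sum_fls_nth[OF k, of j] by (auto simp: sum.neutral)
qed

lemma branch_ring_val_ring_param: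
  fixes R :: "'k::field fls set" and x :: "nat \<Rightarrow> 'k fls"
  assumes R: "branch_ring R" and pres: "presentation R n x" and n: "n \<ge> 2"
    and x: "\<And>i. i \<in> {1..n} \<Longrightarrow> \<alpha> i dvd 1 \<and> x i = fps_to_fls (\<alpha> i) * fls_X ^ a i"
    and a: "strict_mono_on {1..n} a"
  shows "val_ring_param R (x 1) (a 1)"
proof -
  have ring: "ring (ring_on R)" using R unfolding branch_ring_def domain_def cring_def by blast
  have add: "f + g \<in> R" and mult: "f * g \<in> R" if "f \<in> R" "g \<in> R" for f g
    using ring.ring_simprules(1,5)[OF ring] that by (simp_all add: ring_on_def)
  have const: "fls_const b \<in> R" for b using R unfolding branch_ring_def by blast
  have R01: "0 \<in> R" "1 \<in> R" "-1 \<in> R" using const[of 0] const[of 1] const[of "-1"] by auto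
  have closure: "int_closure R = ordge 0" using R unfolding branch_ring_def range_fps_to_fls by blast
  \<comment> \<open>Each \<open>r\<close> is a root of the monic polynomial \<open>Y - r\<close>, so
    \<open>R\<close> lies in its integral closure \<open>k[[t]]\<close>.\<close>
  have nonneg: "R \<subseteq> ordge 0"
  proof
    fix r assume r: "r \<in> R"
    have "r = r / 1" by simp
    then have "r \<in> frac_field R" unfolding frac_field_def using r R01(2) by (metis (mono_tags, lifting) mem_Collect_eq zero_neq_one)
    moreover have "Polynomial.coeff [:- r, 1:] i \<in> R" for i
      using mult[OF R01(3) r] R01 by (auto simp: coeff_pCons split: nat.split)
    moreover have "Polynomial.poly [:- r, 1:] r = 0" "Polynomial.lead_coeff [:- r, 1:] = 1" by simp_all
    ultimately have "r \<in> int_closure R" unfolding int_closure_def by blast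
    then show "r \<in> ordge 0" using closure by simp
  qed
  \<comment> \<open>\<open>int_closure\<close> is by definition a subset of
    \<open>frac_field\<close>, so \<open>t\<close> is a fraction of elements of
    \<open>R\<close>.\<close>
  have X: "fls_X \<in> frac_field R"
  proof -
    have "(fls_X :: 'k fls) \<in> ordge 0" by (auto simp: ordge_def)
    then show ?thesis unfolding closure[symmetric] int_closure_def by blast
  qed
  have sub: "x i \<noteq> 0" "fls_subdegree (x i) = int (a i)" if "i \<in> {1..n}" for i
  proof -
    have u: "\<alpha> i $ 0 \<noteq> 0" using x[OF that] fps_is_unit_iff by blast
    then have "\<alpha> i \<noteq> 0" "subdegree (\<alpha> i) = 0" by auto
    then show "x i \<noteq> 0" "fls_subdegree (x i) = int (a i)"
      using x[OF that] by (simp_all add: fls_subdegree_fls_to_fps)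
  qed
  have I: "1 \<in> {1..n}" "2 \<in> {1..n}" using n by auto
  have "a 1 < a 2" using strict_mono_onD[OF a I] by simp
  have RP: "R = power_series_ring {1..n} x" using pres unfolding presentation_def by blast
  \<comment> \<open>The expansion uses \<open>x 2\<close>, whose order is positive because
    \<open>a 2 > a 1 \<ge> 0\<close>. That \<open>a 1\<close> is positive follows only afterwards,
    from the description of the maximal ideal, which needs this tail.\<close>
  have tail: "\<exists>N::nat. ordge (int N) \<subseteq> R"
  proof (rule tail_subset[OF R01(1,2) add mult nonneg X sub[OF I(2)]])
    show "0 < a 2" using \<open>a 1 < a 2\<close> by simp
    fix Z d assume Z: "\<And>M. Z - (\<Sum>m<M. fls_const (d m) * x 2 ^ m) \<in> ordge (int M)"
    have "x 2 \<in> ordge 1" using sub[OF I(2)] \<open>a 1 < a 2\<close> by (simp add: ordge_iff)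
    then show "Z \<in> R" unfolding RP using Z I(2)
      by (intro power_series_ring_geometric[of "{1..n}" 2 Z d x]) auto
  qed
  interpret val_ring R
    by unfold_locales (use nonneg const add mult tail in auto)
  have x1: "x 1 \<in> R" "x 1 \<in> ordge 1"
    using pres I(1) unfolding presentation_def max_ideal_eq by blast+
  show ?thesis
  proof
    show "x 1 \<in> R" "x 1 \<noteq> 0" "fls_subdegree (x 1) = int (a 1)" using x1 sub[OF I(1)] by auto
    show "0 < a 1" using x1 sub[OF I(1)] by (auto simp: ordge_iff)
    fix h assume h: "h \<in> val_semigroup R - {0}"
    show "a 1 \<le> h"
    proof (rule ccontr)
      assume "\<not> a 1 \<le> h"
      have "x i \<in> ordge (int (a 1))" if "i \<in> {1..n}" for i
        using sub[OF that] strict_mono_on_leD[OF a I(1) that] that by (simp add: ordge_iff)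
      then have "r $$ int h = 0" if "r \<in> R" for r
        using that h \<open>\<not> a 1 \<le> h\<close> unfolding RP by (intro order_of_presentation[of r "{1..n}" x "a 1"]) auto
      moreover obtain r where "r \<in> R" "r $$ int h \<noteq> 0" using h by (auto simp: val_iff)
      ultimately show False by blast
    qed
  qed
qed

section \<open>Comparison of \<open>R\<close> with its semigroup ring\<close>

theorem theorem1:
  fixes R S :: "'k::{alg_closed_field, field_char_0} fls set"
    and n :: nat and x :: "nat \<Rightarrow> 'k fls" and \<alpha> :: "nat \<Rightarrow> 'k fps" and a :: "nat \<Rightarrow> nat"
    and y :: "'k fls"
  assumes R: "branch_ring R"
    and pres: "presentation R n x"
    and n: "n \<ge> 2" "edim R = enat n"
    and x: "\<And>i. i \<in> {1..n} \<Longrightarrow> \<alpha> i dvd 1 \<and> x i = fps_to_fls (\<alpha> i) * fls_X ^ a i"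
    and a: "strict_mono_on {1..n} a"
    and S: "S = semigroup_ring (val_semigroup R)"
    and y: "y = fls_X ^ Min (min_gens (val_semigroup R))"
  shows "(minimal_reduced_type R (x 1) \<longleftrightarrow> minimal_reduced_type S y)
    \<and> (maximal_reduced_type S y \<longrightarrow> maximal_reduced_type R (x 1))
    \<and> (cm_type R (x 1) = cm_type S y \<longrightarrow>
         maximal_reduced_type R (x 1) \<longrightarrow> maximal_reduced_type S y)
    \<and> (minimal_multiplicity R \<or> almost_Gorenstein R (x 1) \<longrightarrow>
         (maximal_reduced_type R (x 1) \<longleftrightarrow> maximal_reduced_type S y))"
proof -
  interpret R: val_ring_param R "x 1" "a 1"
    by (rule branch_ring_val_ring_param[OF R pres n(1) x a])
  interpret H: numerical_semigroup "val_semigroup R"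
    by unfold_locales (use R.zero_val R.add_val R.val_tail in auto)
  note e = R.e_val R.e_pos R.e_least
  have "Min (min_gens (val_semigroup R)) = a 1" by (rule H.Min_min_gens) (fact e)+
  then have yX: "y = fls_X ^ a 1" unfolding y by simp
  interpret S: val_ring_param S y "a 1"
    unfolding S yX by (rule H.val_ring_param_semigroup_ring) (fact e)+
  have valS: "val_semigroup S = val_semigroup R" unfolding S by (rule H.val_semigroup_ring)
  have red: "reduced_type R (x 1) = reduced_type S y"
    unfolding R.reduced_type_eq S.reduced_type_eq R.c_def S.c_def valS ..
  have cmS: "cm_type S y = enat (card (socle_vals (val_semigroup R) (a 1) - (+) (a 1) ` val_semigroup R))"
  proof -
    have "val_semigroup S.socle = socle_vals (val_semigroup R) (a 1)"
      unfolding S yX by (rule H.val_socle_semigroup_ring) (fact e)+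
    then show ?thesis unfolding S.cm_type_eq valS by simp
  qed
  \<comment> \<open>The reduced types agree, so a reduced type equal to \<open>cm_type S y\<close>
    collapses this chain; if the two types agree, both maximality conditions are the same
    equation.\<close>
  have le: "reduced_type R (x 1) \<le> cm_type R (x 1)" "cm_type R (x 1) \<le> cm_type S y"
    using R.reduced_type_le_cm_type R.cm_type_le unfolding cmS .
  have "a 1 \<noteq> 1" using R.edim_le n by auto
  then have eq: "cm_type R (x 1) = cm_type S y" if "minimal_multiplicity R \<or> almost_Gorenstein R (x 1)"
    using that R.almost_Gorenstein_socle R.minimal_multiplicity_socle R.cm_type_eq cmS by metis
  show ?thesis
    using red le eq unfolding minimal_reduced_type_def maximal_reduced_type_def
    by (metis order_antisym)
qed

end
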